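(* Let $\Sigma$ be a discrete projective minimal surface, and consider any associated envelope $\Omega$ whose edges, in either direction, are not shared generators of the lattice Lie quadrics of $\Sigma$. Then $\Sigma$ is a discrete Demoulin surface if and only if there exists a line congruence (among $\mathscr L,\mathscr L^1,\mathscr L^2,\mathscr L^{12}$) associated with $\Omega$ which has the intersection property in both directions $n_1$ and $n_2$.
   Context: Discrete asymptotic net: a map $\mathbf r:\mathbb Z^2\to\mathbb R^4$ (homogeneous coordinates of points of $\mathbb P^3$) such that every star (a vertex and its four neighbours) is planar. Subscripts $1,2$ (resp. $\bar 1,\bar 2$) denote unit increments (resp. decrements) of $n_1,n_2$. It is assumed that $\mathbf r,\mathbf r_1,\mathbf r_2,\mathbf r_{12}$ are linearly independent, so that $\mathbf r_{11}=\alpha^0\mathbf r+\alpha^1\mathbf r_1+\alpha^3\mathbf r_{12}$, $\mathbf r_{112}=\beta^1\mathbf r_1+\beta^2\mathbf r_2+\beta^3\mathbf r_{12}$, $\mathbf r_{22}=\gamma^0\mathbf r+\gamma^2\mathbf r_2+\gamma^3\mathbf r_{12}$, $\mathbf r_{122}=\delta^1\mathbf r_1+\delta^2\mathbf r_2+\delta^3\mathbf r_{12}$ (the upper indices are labels; all coefficients are functions on $\mathbb Z^2$), where only $\alpha^1,\beta^3,\gamma^2,\delta^3$ are allowed to vanish. Lattice Lie quadrics: a quadric through the four extended edges of the quadrilateral $[\mathbf r,\mathbf r_1,\mathbf r_2,\mathbf r_{12}]$ is $Q(s,t)=p\,\mathbf r_{12}+s\,\mathbf r_1+t\,\mathbf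 r_2+st\,\mathbf r$, where $p\ne0$ labels the quadric and $s,t$ parametrise its generators. A choice of such a quadric for every quadrilateral (with $p$ a function on $\mathbb Z^2$; the neighbouring quadrics are $Q_1,Q_2$ etc.) is a set of lattice Lie quadrics if the $\mathcal C^1$ condition holds: any two neighbouring quadrics have the same tangent plane at each point of their common edge. Equivalently, $p_1=\alpha^0/(\beta^2p)$ and $p_2=\gamma^0/(\delta^1p)$. A shared generator of two neighbouring quadrics is a line, transversal to (and different from) their common edge, which is a generator of both. Envelope: a lattice $\Omega$ of $\mathbb Z^2$ combinatorics with vertices $\boldsymbol\omega=Q(s,t)\in Q$, one on each quadric, such that the four edges of $\Omega$ emanating from $\boldsymbol\omega$ lie in the tangent plane of $Q$ at $\boldsymbol\omega$. Vertices of envelopes have finite non-zero parameters $s,t$, i.e. do not lie on the extended edges of the corresponding quadrilateral. Homogeneity convention: if a property related to the envelope (such as the edge of $\Omega$ joining $\boldsymbol\omega$ and $\boldsymbol\omega_i$ being a shared generator of $Q$ and $Q_i$, $\boldsymbol\omega$ lying on a generator shared by $Q$ and $Q_i$, or $D^i=0$) holds for one pair of neighbouring quadrics, then it is assumed to hold for all pairs of neighbouring quadrics of the same type (same direction $n_i$). Discriminants: $D^1=(\alpha^0\beta^3-\alpha^1\beta^2p)^2+4\alpha^0\alpha^3\beta^1\beta^2p$, $D^2=(\gamma^0\delta^3-\gamma^2\delta^1p)^2+4\gamma^0\gamma^3\delta^1\delta^2p$. Discrete projective minimal surface: put $T^1=D^1/(\alpha^0\beta^2p)^2$, $T^2=D^2/(\gamma^0\delta^1p)^2$.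 A discrete asymptotic net (with an associated set of lattice Lie quadrics) is discrete projective minimal if $T^1_2-T^1=0$ or, equivalently, $T^2_1-T^2=0$ in a gauge $\mathbf r\to x\mathbf r$ in which $(1-p^2)\frac{\beta^2\delta^1}{\beta^1\delta^2}=1$. Expressed in an arbitrary gauge, this condition is $\bigl(1-\frac{\beta^1\delta^2}{\beta^2\delta^1}\bigr)T^1_2=p^2T^1$ or, equivalently, $\bigl(1-\frac{\beta^1\delta^2}{\beta^2\delta^1}\bigr)T^2_1=p^2T^2$. Discrete Demoulin surface: a discrete asymptotic net (with lattice Lie quadrics) with $D^1=D^2=0$ on all of $\mathbb Z^2$. Line congruences associated with $\Omega$: $\mathscr L,\mathscr L^1,\mathscr L^2,\mathscr L^{12}$ are the $\mathbb Z^2$-families of lines joining the vertex $\boldsymbol\omega\in Q$ to $\mathbf r,\mathbf r_1,\mathbf r_2,\mathbf r_{12}$ respectively, where $[\mathbf r,\mathbf r_1,\mathbf r_2,\mathbf r_{12}]$ is the quadrilateral to which $Q$ belongs. A discrete line congruence $\{l(n_1,n_2)\}$ has the intersection property in the direction $n_i$ if $l\cap l_i\ne\emptyset$ for all $(n_1,n_2)$. *)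

theory Defs
  imports "HOL-Analysis.Analysis"
begin

text \<open>
  Points of projective 3-space are given by nonzero vectors of \<open>real ^ 4\<close>, and projective subspaces
  by linear subspaces: lines have linear dimension 2, planes have linear dimension 3.
  For a lattice function \<open>f\<close>, the subscripts 1 and 2 are the shifts \<open>f (n+1) m\<close> and \<open>f n (m+1)\<close>.
\<close>

type_synonym net = "int \<Rightarrow> int \<Rightarrow> real ^ 4"
type_synonym lattice_fun = "int \<Rightarrow> int \<Rightarrow> real"


section \<open>Discrete asymptotic nets\<close>

definition star :: "net \<Rightarrow> int \<Rightarrow> int \<Rightarrow> (real ^ 4) set" where
  "star r n m = {r n m, r (n+1) m, r (n-1) m, r n (m+1), r n (m-1)}"

text \<open>
  The coordinates of \<open>v\<close> with respect to the frame \<open>r, r\<^sub>1, r\<^sub>2, r\<^sub>1\<^sub>2\<close>.  The index type \<open>4\<close> is the ring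
  of integers modulo 4, so its elements are \<open>0, 1, 2, 3\<close> (and \<open>4 = 0\<close>); the indices
  \<open>0, 1, 2, 3\<close> refer to \<open>r, r\<^sub>1, r\<^sub>2, r\<^sub>1\<^sub>2\<close> and are the upper labels of the coefficients below.
\<close>

definition frame_coords :: "net \<Rightarrow> int \<Rightarrow> int \<Rightarrow> real ^ 4 \<Rightarrow> real ^ 4" where
  "frame_coords r n m v = (THE c. v = c $ 0 *\<^sub>R r n m + c $ 1 *\<^sub>R r (n+1) m
                                     + c $ 2 *\<^sub>R r n (m+1) + c $ 3 *\<^sub>R r (n+1) (m+1))"

definition \<alpha> :: "net \<Rightarrow> int \<Rightarrow> int \<Rightarrow> real ^ 4" where
  "\<alpha> r n m = frame_coords r n m (r (n+2) m)"

definition \<beta> :: "net \<Rightarrow> int \<Rightarrow> int \<Rightarrow> real ^ 4" where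
  "\<beta> r n m = frame_coords r n m (r (n+2) (m+1))"

definition \<gamma> :: "net \<Rightarrow> int \<Rightarrow> int \<Rightarrow> real ^ 4" where
  "\<gamma> r n m = frame_coords r n m (r n (m+2))"

definition \<delta> :: "net \<Rightarrow> int \<Rightarrow> int \<Rightarrow> real ^ 4" where
  "\<delta> r n m = frame_coords r n m (r (n+1) (m+2))"

text \<open>
  Planarity of the stars makes the coefficients \<open>\<alpha>\<^sup>2, \<beta>\<^sup>0, \<gamma>\<^sup>1, \<delta>\<^sup>0\<close> vanish;
  among the remaining ones only \<open>\<alpha>\<^sup>1, \<beta>\<^sup>3, \<gamma>\<^sup>2, \<delta>\<^sup>3\<close> are allowed to be zero.
\<close>

definition discrete_asymptotic_net :: "net \<Rightarrow> bool" where
  "discrete_asymptotic_net r \<longleftrightarrow>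
     (\<forall>n m. dim (star r n m) \<le> 3) \<and>
     (\<forall>n m. distinct [r n m, r (n+1) m, r n (m+1), r (n+1) (m+1)] \<and>
            independent {r n m, r (n+1) m, r n (m+1), r (n+1) (m+1)}) \<and>
     (\<forall>n m. \<alpha> r n m $ 0 \<noteq> 0 \<and> \<alpha> r n m $ 3 \<noteq> 0 \<and>
            \<beta> r n m $ 1 \<noteq> 0 \<and> \<beta> r n m $ 2 \<noteq> 0 \<and>
            \<gamma> r n m $ 0 \<noteq> 0 \<and> \<gamma> r n m $ 3 \<noteq> 0 \<and>
            \<delta> r n m $ 1 \<noteq> 0 \<and> \<delta> r n m $ 2 \<noteq> 0)"


section \<open>Lattice Lie quadrics\<close>

text \<open>
  The parametrisation of the quadric, with homogeneous parameters \<open>s = \<sigma>\<^sub>1 / \<sigma>\<^sub>0\<close> and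
  \<open>t = \<tau>\<^sub>1 / \<tau>\<^sub>0\<close> in order to include infinite parameter values.
\<close>

fun quadric_point :: "net \<Rightarrow> lattice_fun \<Rightarrow> int \<Rightarrow> int \<Rightarrow> real \<times> real \<Rightarrow> real \<times> real \<Rightarrow> real ^ 4" where
  "quadric_point r p n m (\<sigma>0, \<sigma>1) (\<tau>0, \<tau>1) =
     (\<sigma>0 * \<tau>0 * p n m) *\<^sub>R r (n+1) (m+1) + (\<sigma>1 * \<tau>0) *\<^sub>R r (n+1) m
     + (\<sigma>0 * \<tau>1) *\<^sub>R r n (m+1) + (\<sigma>1 * \<tau>1) *\<^sub>R r n m"

definition quadric :: "net \<Rightarrow> lattice_fun \<Rightarrow> int \<Rightarrow> int \<Rightarrow> (real ^ 4) set" where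
  "quadric r p n m = {quadric_point r p n m \<sigma> \<tau> | \<sigma> \<tau>. \<sigma> \<noteq> (0, 0) \<and> \<tau> \<noteq> (0, 0)}"

text \<open>
  The parametrisation is bilinear, and its differential at \<open>(\<sigma>, \<tau>)\<close> sends \<open>(\<sigma>', \<tau>')\<close> to
  \<open>quadric_point \<sigma>' \<tau> + quadric_point \<sigma> \<tau>'\<close>; the tangent plane is the image of this differential.
  At a point of the quadric it does not depend on the choice of \<open>(\<sigma>, \<tau>)\<close>.
\<close>

definition tangent_plane :: "net \<Rightarrow> lattice_fun \<Rightarrow> int \<Rightarrow> int \<Rightarrow> real ^ 4 \<Rightarrow> (real ^ 4) set" where
  "tangent_plane r p n m x =
     {quadric_point r p n m \<sigma>' \<tau> + quadric_point r p n m \<sigma> \<tau>' | \<sigma> \<tau> \<sigma>' \<tau>'.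
        quadric_point r p n m \<sigma> \<tau> = x}"

definition common_edge1 :: "net \<Rightarrow> int \<Rightarrow> int \<Rightarrow> (real ^ 4) set" where
  "common_edge1 r n m = span {r (n+1) m, r (n+1) (m+1)}"

definition common_edge2 :: "net \<Rightarrow> int \<Rightarrow> int \<Rightarrow> (real ^ 4) set" where
  "common_edge2 r n m = span {r n (m+1), r (n+1) (m+1)}"

definition lattice_Lie_quadrics :: "net \<Rightarrow> lattice_fun \<Rightarrow> bool" where
  "lattice_Lie_quadrics r p \<longleftrightarrow>
     (\<forall>n m. p n m \<noteq> 0) \<and>
     (\<forall>n m. \<forall>x \<in> common_edge1 r n m - {0}.
        tangent_plane r p n m x = tangent_plane r p (n+1) m x) \<and>
     (\<forall>n m. \<forall>x \<in> common_edge2 r n m - {0}.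
        tangent_plane r p n m x = tangent_plane r p n (m+1) x)"

definition generator :: "(real ^ 4) set \<Rightarrow> (real ^ 4) set \<Rightarrow> bool" where
  "generator X g \<longleftrightarrow> subspace g \<and> dim g = 2 \<and> g - {0} \<subseteq> X"

text \<open>Transversality to the common edge \<open>e\<close>: the generator meets \<open>e\<close> in exactly one point.\<close>

definition shared_generator ::
    "(real ^ 4) set \<Rightarrow> (real ^ 4) set \<Rightarrow> (real ^ 4) set \<Rightarrow> (real ^ 4) set \<Rightarrow> bool" where
  "shared_generator X Y e g \<longleftrightarrow> generator X g \<and> generator Y g \<and> dim (g \<inter> e) = 1"

definition shared_generator1 :: "net \<Rightarrow> lattice_fun \<Rightarrow> int \<Rightarrow> int \<Rightarrow> (real ^ 4) set \<Rightarrow> bool" where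
  "shared_generator1 r p n m g \<longleftrightarrow>
     shared_generator (quadric r p n m) (quadric r p (n+1) m) (common_edge1 r n m) g"

definition shared_generator2 :: "net \<Rightarrow> lattice_fun \<Rightarrow> int \<Rightarrow> int \<Rightarrow> (real ^ 4) set \<Rightarrow> bool" where
  "shared_generator2 r p n m g \<longleftrightarrow>
     shared_generator (quadric r p n m) (quadric r p n (m+1)) (common_edge2 r n m) g"


section \<open>Projective minimal and Demoulin surfaces\<close>

definition D1 :: "net \<Rightarrow> lattice_fun \<Rightarrow> lattice_fun" where
  "D1 r p n m = (\<alpha> r n m $ 0 * \<beta> r n m $ 3 - \<alpha> r n m $ 1 * \<beta> r n m $ 2 * p n m)\<^sup>2
                + 4 * \<alpha> r n m $ 0 * \<alpha> r n m $ 3 * \<beta> r n m $ 1 * \<beta> r n m $ 2 * p n m"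

definition D2 :: "net \<Rightarrow> lattice_fun \<Rightarrow> lattice_fun" where
  "D2 r p n m = (\<gamma> r n m $ 0 * \<delta> r n m $ 3 - \<gamma> r n m $ 2 * \<delta> r n m $ 1 * p n m)\<^sup>2
                + 4 * \<gamma> r n m $ 0 * \<gamma> r n m $ 3 * \<delta> r n m $ 1 * \<delta> r n m $ 2 * p n m"

definition T1 :: "net \<Rightarrow> lattice_fun \<Rightarrow> lattice_fun" where
  "T1 r p n m = D1 r p n m / (\<alpha> r n m $ 0 * \<beta> r n m $ 2 * p n m)\<^sup>2"

text \<open>
  Projective minimality in an arbitrary gauge.  In a gauge with \<open>(1 - p\<^sup>2) \<beta>\<^sup>2 \<delta>\<^sup>1 = \<beta>\<^sup>1 \<delta>\<^sup>2\<close> the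
  condition reads \<open>T1 n (m+1) = T1 n m\<close>, but over the reals such a gauge need not exist.  By the
  compatibility conditions of the net, the analogous condition
  \<open>(1 - \<beta>\<^sup>1 \<delta>\<^sup>2 / (\<beta>\<^sup>2 \<delta>\<^sup>1)) T2 (n+1) m = p\<^sup>2 T2 n m\<close> with \<open>T2 = D2 / (\<gamma>\<^sup>0 \<delta>\<^sup>1 p)\<^sup>2\<close> is equivalent.
\<close>

definition discrete_projective_minimal :: "net \<Rightarrow> lattice_fun \<Rightarrow> bool" where
  "discrete_projective_minimal r p \<longleftrightarrow>
     discrete_asymptotic_net r \<and> lattice_Lie_quadrics r p \<and>
     (\<forall>n m. (1 - \<beta> r n m $ 1 * \<delta> r n m $ 2 / (\<beta> r n m $ 2 * \<delta> r n m $ 1)) * T1 r p n (m+1)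
            = (p n m)\<^sup>2 * T1 r p n m)"

definition discrete_Demoulin :: "net \<Rightarrow> lattice_fun \<Rightarrow> bool" where
  "discrete_Demoulin r p \<longleftrightarrow>
     discrete_asymptotic_net r \<and> lattice_Lie_quadrics r p \<and>
     (\<forall>n m. D1 r p n m = 0 \<and> D2 r p n m = 0)"


section \<open>Envelopes\<close>

text \<open>The vertices of an envelope are encoded by their (finite) parameters \<open>s\<close> and \<open>t\<close>.\<close>

definition \<omega> :: "net \<Rightarrow> lattice_fun \<Rightarrow> lattice_fun \<Rightarrow> lattice_fun \<Rightarrow> net" where
  "\<omega> r p s t n m = quadric_point r p n m (1, s n m) (1, t n m)"

definition edge1 :: "net \<Rightarrow> int \<Rightarrow> int \<Rightarrow> (real ^ 4) set" where
  "edge1 w n m = span {w n m, w (n+1) m}"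

definition edge2 :: "net \<Rightarrow> int \<Rightarrow> int \<Rightarrow> (real ^ 4) set" where
  "edge2 w n m = span {w n m, w n (m+1)}"

text \<open>Edges have linear dimension 2 because they are lines: neighbouring vertices are distinct points.\<close>

definition envelope :: "net \<Rightarrow> lattice_fun \<Rightarrow> lattice_fun \<Rightarrow> lattice_fun \<Rightarrow> bool" where
  "envelope r p s t \<longleftrightarrow>
     (\<forall>n m. s n m \<noteq> 0 \<and> t n m \<noteq> 0) \<and>
     (let w = \<omega> r p s t in
       (\<forall>n m. dim (edge1 w n m) = 2 \<and> dim (edge2 w n m) = 2) \<and>
       (\<forall>n m. edge1 w n m \<subseteq> tangent_plane r p n m (w n m) \<and>
              edge1 w (n-1) m \<subseteq> tangent_plane r p n m (w n m) \<and>
              edge2 w n m \<subseteq> tangent_plane r p n m (w n m) \<and>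
              edge2 w n (m-1) \<subseteq> tangent_plane r p n m (w n m)))"

definition homogeneous :: "(int \<Rightarrow> int \<Rightarrow> bool) \<Rightarrow> bool" where
  "homogeneous P \<longleftrightarrow> ((\<exists>n m. P n m) \<longrightarrow> (\<forall>n m. P n m))"

definition homogeneity_convention ::
    "net \<Rightarrow> lattice_fun \<Rightarrow> lattice_fun \<Rightarrow> lattice_fun \<Rightarrow> bool" where
  "homogeneity_convention r p s t \<longleftrightarrow>
     (let w = \<omega> r p s t in
       homogeneous (\<lambda>n m. shared_generator1 r p n m (edge1 w n m)) \<and>
       homogeneous (\<lambda>n m. shared_generator2 r p n m (edge2 w n m)) \<and>
       homogeneous (\<lambda>n m. \<exists>g. shared_generator1 r p n m g \<and> w n m \<in> g) \<and>
       homogeneous (\<lambda>n m. \<exists>g. shared_generator2 r p n m g \<and> w n m \<in> g) \<and>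
       homogeneous (\<lambda>n m. D1 r p n m = 0) \<and>
       homogeneous (\<lambda>n m. D2 r p n m = 0))"


section \<open>Associated line congruences\<close>

type_synonym line_family = "int \<Rightarrow> int \<Rightarrow> (real ^ 4) set"

definition L :: "net \<Rightarrow> net \<Rightarrow> line_family" where
  "L r w n m = span {w n m, r n m}"

definition L1 :: "net \<Rightarrow> net \<Rightarrow> line_family" where
  "L1 r w n m = span {w n m, r (n+1) m}"

definition L2 :: "net \<Rightarrow> net \<Rightarrow> line_family" where
  "L2 r w n m = span {w n m, r n (m+1)}"

definition L12 :: "net \<Rightarrow> net \<Rightarrow> line_family" where
  "L12 r w n m = span {w n m, r (n+1) (m+1)}"

text \<open>Two projective lines have a common point iff the linear subspaces share a nonzero vector.\<close>

definition intersection_property1 :: "line_family \<Rightarrow> bool" where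
  "intersection_property1 l \<longleftrightarrow> (\<forall>n m. l n m \<inter> l (n+1) m \<noteq> {0})"

definition intersection_property2 :: "line_family \<Rightarrow> bool" where
  "intersection_property2 l \<longleftrightarrow> (\<forall>n m. l n m \<inter> l n (m+1) \<noteq> {0})"

end

theory Submission
  imports Defs
begin

text \<open>
  Expand everything in the frame \<open>r, r\<^sub>1, r\<^sub>2, r\<^sub>1\<^sub>2\<close>.  The sum of the two tangency conditions for the edge
  joining \<open>\<omega>\<close> and \<open>\<omega>\<^sub>1\<close> is bilinear in \<open>(s, s\<^sub>1)\<close> and their difference factorises, one factor being
  \<open>s - p s\<^sub>1\<close>; its vanishing would make the edge a shared generator, so the other factor vanishes and
  determines \<open>t\<^sub>1\<close>.  With \<open>c = p\<^sub>1 \<beta>\<^sup>3 - \<alpha>\<^sup>1\<close> the bilinear relation reads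
  \<open>(2 \<alpha>\<^sup>3 s\<^sub>1 + c) (2 \<alpha>\<^sup>3 s + p c) = p D\<^sup>1 / (p \<beta>\<^sup>2)\<^sup>2\<close>, and the vanishing of the first factor is equivalent to
  the intersection property of \<open>L\<close> and of \<open>L2\<close> in the first direction, that of the second factor to the one
  of \<open>L1\<close> and of \<open>L12\<close>.  If \<open>D\<^sup>1 = 0\<close>, the second factor vanishes iff \<open>\<omega>\<close> lies on a shared generator, so by
  homogeneity the same factor vanishes everywhere.  In the second direction \<open>L1\<close> and \<open>L2\<close> change roles,
  hence each of the four combinations singles out exactly one of the congruences.
\<close>

section \<open>Frames\<close>

definition frame_vector :: "net \<Rightarrow> int \<Rightarrow> int \<Rightarrow> real \<Rightarrow> real \<Rightarrow> real \<Rightarrow> real \<Rightarrow> real ^ 4" where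
  "frame_vector r n m x0 x1 x2 x3 = x0 *\<^sub>R r n m + x1 *\<^sub>R r (n+1) m
     + x2 *\<^sub>R r n (m+1) + x3 *\<^sub>R r (n+1) (m+1)"

section \<open>Linear algebra: spans, coordinates and meeting lines\<close>

lemma in_span_pair_iff: "x \<in> span {a, b} \<longleftrightarrow> (\<exists>u v. x = u *\<^sub>R a + v *\<^sub>R b)"
  for a b :: "'a::real_vector"
proof -
  have "x \<in> span {a, b} \<longleftrightarrow> (\<exists>u v. x - u *\<^sub>R a = v *\<^sub>R b)"
    by (auto simp: span_breakdown_eq)
  also have "\<dots> \<longleftrightarrow> (\<exists>u v. x = u *\<^sub>R a + v *\<^sub>R b)"
    by (metis add.commute diff_add_cancel add_diff_cancel_left')
  finally show ?thesis .
qed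

lemma zero_frame_vector: "frame_vector r n m 0 0 0 0 = 0"
  by (simp add: frame_vector_def)

lemma dim_span_pair:
  fixes a b :: "'a::euclidean_space"
  assumes "\<And>u v. u *\<^sub>R a + v *\<^sub>R b = 0 \<Longrightarrow> u = 0 \<and> v = 0"
  shows "dim (span {a, b}) = 2"
proof -
  have b: "b \<noteq> 0" using assms[of 0 1] by auto
  have "a \<notin> span {b}"
  proof
    assume "a \<in> span {b}"
    then obtain k where "a = k *\<^sub>R b" by (auto simp: span_singleton)
    then show False using assms[of 1 "- k"] by simp
  qed
  then show ?thesis
    using b by (simp add: dim_insert dim_singleton)
qed

lemma independent_4_eq_0D:
  fixes a b c d :: "'a::real_vector"
  assumes "distinct [a, b, c, d]" "independent {a, b, c, d}"
    and "x0 *\<^sub>R a + x1 *\<^sub>R b + x2 *\<^sub>R c + x3 *\<^sub>R d = 0"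
  shows "x0 = 0 \<and> x1 = 0 \<and> x2 = 0 \<and> x3 = 0"
proof -
  define u where "u = (\<lambda>v. if v = a then x0 else if v = b then x1 else if v = c then x2 else x3)"
  have u: "u a = x0" "u b = x1" "u c = x2" "u d = x3"
    using assms(1) by (auto simp: u_def)
  have "(\<Sum>v\<in>{a, b, c, d}. u v *\<^sub>R v) = 0"
    using assms(1,3) by (simp add: u add.assoc)
  then have "u v = 0" if "v \<in> {a, b, c, d}" for v
    using independentD[OF assms(2) _ subset_refl _ that, of u] by simp
  then show ?thesis
    unfolding u[symmetric] by simp
qed

lemma independent_4_eq_iff:
  fixes a b c d :: "'a::real_vector"
  assumes "distinct [a, b, c, d]" "independent {a, b, c, d}"
  shows "x0 *\<^sub>R a + x1 *\<^sub>R b + x2 *\<^sub>R c + x3 *\<^sub>R d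
       = y0 *\<^sub>R a + y1 *\<^sub>R b + y2 *\<^sub>R c + y3 *\<^sub>R d
     \<longleftrightarrow> x0 = y0 \<and> x1 = y1 \<and> x2 = y2 \<and> x3 = y3" (is "?l \<longleftrightarrow> ?r")
proof
  assume ?l
  then have "(x0 - y0) *\<^sub>R a + (x1 - y1) *\<^sub>R b + (x2 - y2) *\<^sub>R c + (x3 - y3) *\<^sub>R d = 0"
    by (simp add: algebra_simps)
  from independent_4_eq_0D[OF assms this] show ?r by simp
qed simp

text \<open>Otherwise \<open>v\<close> would extend \<open>a, b, c\<close> to four independent
  vectors in a set of dimension at most 3. This turns planarity of a star into the vanishing of a
  frame coefficient.\<close>

lemma in_span_of_coplanar:
  fixes a b c v :: "'a::euclidean_space"
  assumes "distinct [a, b, c]" "independent {a, b, c}"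
    and "dim S \<le> 3" "{a, b, c} \<subseteq> S" "v \<in> S"
  shows "v \<in> span {a, b, c}"
proof (rule ccontr)
  assume v: "v \<notin> span {a, b, c}"
  then have ind: "independent (insert v {a, b, c})"
    using assms(2) by (rule independent_insertI)
  have "v \<noteq> a" "v \<noteq> b" "v \<noteq> c"
    using v span_base[of _ "{a, b, c}"] by auto
  then have "card (insert v {a, b, c}) = 4"
    using assms(1) by simp
  moreover have "insert v {a, b, c} \<subseteq> S"
    using assms(4,5) by simp
  ultimately show False
    using independent_card_le_dim[OF _ ind, of S] assms(3) by simp
qed

text \<open>The lines meet when \<open>w, a, v, b\<close> are coplanar; modulo the line through
  \<open>a\<close> and \<open>b\<close> this says that the \<open>(c, d)\<close>-parts of
  \<open>w\<close> and \<open>v\<close> are proportional. Every intersection criterion below is an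
  instance for a suitable ordering of a frame.\<close>

lemma lines_meet_iff:
  fixes a b c d :: "real ^ 4"
  assumes ind: "distinct [a, b, c, d]" "independent {a, b, c, d}"
    and w: "w = w0 *\<^sub>R a + w1 *\<^sub>R b + w2 *\<^sub>R c + w3 *\<^sub>R d"
    and v: "v = v0 *\<^sub>R a + v1 *\<^sub>R b + v2 *\<^sub>R c + v3 *\<^sub>R d"
    and nz: "w2 \<noteq> 0" "v2 \<noteq> 0"
  shows "span {w, a} \<inter> span {v, b} \<noteq> {0} \<longleftrightarrow> w2 * v3 = w3 * v2"
proof
  assume "span {w, a} \<inter> span {v, b} \<noteq> {0}"
  moreover have "0 \<in> span {w, a} \<inter> span {v, b}"
    by (simp add: span_zero)
  ultimately obtain x where x: "x \<noteq> 0" "x \<in> span {w, a}" "x \<in> span {v, b}"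
    by blast
  then obtain i j k l where ij: "x = i *\<^sub>R w + j *\<^sub>R a" and kl: "x = k *\<^sub>R v + l *\<^sub>R b"
    unfolding in_span_pair_iff by blast
  have "(i * w0 + j) *\<^sub>R a + (i * w1) *\<^sub>R b + (i * w2) *\<^sub>R c + (i * w3) *\<^sub>R d
      = (k * v0) *\<^sub>R a + (k * v1 + l) *\<^sub>R b + (k * v2) *\<^sub>R c + (k * v3) *\<^sub>R d"
    using ij kl unfolding w v by (simp add: algebra_simps)
  note eqs = this[unfolded independent_4_eq_iff[OF ind]]
  \<comment> \<open>With \<open>k = 0\<close> the \<open>c\<close>-coordinate gives
    \<open>i = 0\<close>, then the \<open>b\<close>-coordinate gives \<open>l = 0\<close>, and
    \<open>x\<close> would vanish.\<close>
  have "k \<noteq> 0"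
    using eqs nz x(1) kl by auto
  moreover have "k * (w2 * v3) = k * (w3 * v2)"
    using eqs by (metis mult.assoc mult.commute)
  ultimately show "w2 * v3 = w3 * v2" by simp
next
  assume eq: "w2 * v3 = w3 * v2"
  \<comment> \<open>By \<open>eq\<close>, \<open>v2 *\<^sub>R w\<close> and
    \<open>w2 *\<^sub>R v\<close> agree in the coordinates along \<open>c\<close> and
    \<open>d\<close>. The common point takes its \<open>b\<close>-coordinate from the former and its
    \<open>a\<close>-coordinate from the latter.\<close>
  define x where "x = 0 *\<^sub>R a + (v2 * w1) *\<^sub>R b + (v2 * w2) *\<^sub>R c + (v2 * w3) *\<^sub>R d
    + (w2 * v0) *\<^sub>R a"
  have "x = v2 *\<^sub>R w + (w2 * v0 - v2 * w0) *\<^sub>R a"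
    unfolding x_def w by (simp add: algebra_simps)
  moreover have "x = w2 *\<^sub>R v + (v2 * w1 - w2 * v1) *\<^sub>R b"
    using eq unfolding x_def v by (simp add: algebra_simps)
  ultimately have "x \<in> span {w, a} \<inter> span {v, b}"
    unfolding Int_iff in_span_pair_iff by blast
  moreover have "x = (w2 * v0) *\<^sub>R a + (v2 * w1) *\<^sub>R b + (v2 * w2) *\<^sub>R c + (v2 * w3) *\<^sub>R d"
    by (simp add: x_def)
  then have "x \<noteq> 0"
    using independent_4_eq_0D[OF ind, of "w2 * v0" "v2 * w1" "v2 * w2" "v2 * w3"] nz by auto
  ultimately show "span {w, a} \<inter> span {v, b} \<noteq> {0}" by blast
qed

section \<open>The moving frame: structure equations and change of frame\<close>

context
  fixes r :: net
  assumes net: "discrete_asymptotic_net r"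
begin

lemma frame_independent:
  "distinct [r n m, r (n+1) m, r n (m+1), r (n+1) (m+1)]"
  "independent {r n m, r (n+1) m, r n (m+1), r (n+1) (m+1)}"
  using net unfolding discrete_asymptotic_net_def by blast+

lemma star_coplanar: "dim (star r n m) \<le> 3"
  using net by (simp add: discrete_asymptotic_net_def)

lemma coefficients_nonzero:
  "\<alpha> r n m $ 0 \<noteq> 0" "\<alpha> r n m $ 3 \<noteq> 0" "\<beta> r n m $ 1 \<noteq> 0" "\<beta> r n m $ 2 \<noteq> 0"
  using net by (simp_all add: discrete_asymptotic_net_def)

lemma frame_vector_eq_iff:
  "frame_vector r n m x0 x1 x2 x3 = frame_vector r n m y0 y1 y2 y3
     \<longleftrightarrow> x0 = y0 \<and> x1 = y1 \<and> x2 = y2 \<and> x3 = y3"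
  unfolding frame_vector_def by (rule independent_4_eq_iff[OF frame_independent])

lemma frame_coords_eqI:
  assumes "v = frame_vector r n m (c $ 0) (c $ 1) (c $ 2) (c $ 3)"
  shows "frame_coords r n m v = c"
  unfolding frame_coords_def
proof (rule the_equality)
  fix c' :: "real ^ 4"
  assume "v = c' $ 0 *\<^sub>R r n m + c' $ 1 *\<^sub>R r (n+1) m
    + c' $ 2 *\<^sub>R r n (m+1) + c' $ 3 *\<^sub>R r (n+1) (m+1)"
  then have "frame_vector r n m (c' $ 0) (c' $ 1) (c' $ 2) (c' $ 3)
      = frame_vector r n m (c $ 0) (c $ 1) (c $ 2) (c $ 3)"
    using assms by (simp add: frame_vector_def)
  then have "c' $ i = c $ i" if "i \<in> {0, 1, 2, 3}" for i
    using that unfolding frame_vector_eq_iff by auto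
  moreover have "i \<in> {0, 1, 2, 3}" for i :: 4
    using exhaust_4[of i] by auto
  ultimately show "c' = c" by (simp add: vec_eq_iff)
qed (use assms in \<open>simp add: frame_vector_def\<close>)

lemma frame_vector_ex: "\<exists>x0 x1 x2 x3. v = frame_vector r n m x0 x1 x2 x3"
proof -
  let ?B = "{r n m, r (n+1) m, r n (m+1), r (n+1) (m+1)}"
  have "card ?B = 4" using frame_independent(1)[of n m] by simp
  then have "span ?B = UNIV"
    using card_eq_dim[of ?B UNIV] frame_independent(2)[of n m] by (auto simp: dim_UNIV)
  then have "v \<in> span ?B" by simp
  then obtain x0 x1 x2 x3 where
    "v - x0 *\<^sub>R r n m - x1 *\<^sub>R r (n+1) m - x2 *\<^sub>R r n (m+1) = x3 *\<^sub>R r (n+1) (m+1)"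
    unfolding span_breakdown_eq by auto
  then have "v = frame_vector r n m x0 x1 x2 x3"
    by (simp add: frame_vector_def algebra_simps)
  then show ?thesis by blast
qed

text \<open>Coordinates exist and are unique, so the definite description in
  \<open>frame_coords\<close> really denotes them.\<close>

lemma frame_vector_frame_coords:
  "frame_vector r n m (frame_coords r n m v $ 0) (frame_coords r n m v $ 1)
     (frame_coords r n m v $ 2) (frame_coords r n m v $ 3) = v"
proof -
  obtain x0 x1 x2 x3 where v: "v = frame_vector r n m x0 x1 x2 x3"
    using frame_vector_ex by blast
  define c :: "real ^ 4" where
    "c = (\<chi> i. if i = 0 then x0 else if i = 1 then x1 else if i = 2 then x2 else x3)"
  have "v = frame_vector r n m (c $ 0) (c $ 1) (c $ 2) (c $ 3)"
    unfolding c_def v by simp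
  from frame_coords_eqI[OF this] this show ?thesis by simp
qed

lemma \<alpha>_frame_vector: "frame_vector r n m (\<alpha> r n m $ 0) (\<alpha> r n m $ 1)
    (\<alpha> r n m $ 2) (\<alpha> r n m $ 3) = r (n+2) m"
  unfolding \<alpha>_def by (rule frame_vector_frame_coords)

lemma \<beta>_frame_vector: "frame_vector r n m (\<beta> r n m $ 0) (\<beta> r n m $ 1)
    (\<beta> r n m $ 2) (\<beta> r n m $ 3) = r (n+2) (m+1)"
  unfolding \<beta>_def by (rule frame_vector_frame_coords)

text \<open>The star of \<open>r\<^sub>1\<close> contains
  \<open>r, r\<^sub>1, r\<^sub>1\<^sub>2\<close> and \<open>r\<^sub>1\<^sub>1\<close>; its planarity
  removes the component along \<open>r\<^sub>2\<close>.\<close>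

lemma r_11: "r (n+2) m = frame_vector r n m (\<alpha> r n m $ 0) (\<alpha> r n m $ 1) 0 (\<alpha> r n m $ 3)"
proof -
  have n: "n + 1 + 1 = n + 2" "n + 1 - 1 = n" "m + 1 - 1 = m" by simp_all
  let ?S = "{r n m, r (n+1) m, r (n+1) (m+1)}"
  have "r (n+2) m \<in> span ?S"
  proof (rule in_span_of_coplanar)
    show "independent ?S"
      by (rule independent_mono[OF frame_independent(2)[of n m]]) blast
    show "dim (star r (n+1) m) \<le> 3"
      by (rule star_coplanar)
    show "?S \<subseteq> star r (n+1) m" "r (n+2) m \<in> star r (n+1) m"
      unfolding star_def n by blast+
  qed (use frame_independent(1)[of n m] in simp)
  then obtain x0 x1 x3 where "r (n+2) m - x0 *\<^sub>R r n m - x1 *\<^sub>R r (n+1) m = x3 *\<^sub>R r (n+1) (m+1)"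
    unfolding span_breakdown_eq by auto
  then have "r (n+2) m = frame_vector r n m x0 x1 0 x3"
    by (simp add: frame_vector_def algebra_simps)
  moreover note \<alpha>_frame_vector[of n m, symmetric]
  ultimately have "\<alpha> r n m $ 2 = 0"
    by (simp add: frame_vector_eq_iff)
  with \<alpha>_frame_vector[of n m] show ?thesis by simp
qed

text \<open>Here the star of \<open>r\<^sub>1\<^sub>2\<close> is used, which contains
  \<open>r\<^sub>1, r\<^sub>2\<close> and \<open>r\<^sub>1\<^sub>1\<^sub>2\<close> but not
  \<open>r\<close>.\<close>

lemma r_112: "r (n+2) (m+1) = frame_vector r n m 0 (\<beta> r n m $ 1) (\<beta> r n m $ 2) (\<beta> r n m $ 3)"
proof -
  have n: "n + 1 + 1 = n + 2" "n + 1 - 1 = n" "m + 1 - 1 = m" by simp_all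
  let ?S = "{r (n+1) m, r n (m+1), r (n+1) (m+1)}"
  have "r (n+2) (m+1) \<in> span ?S"
  proof (rule in_span_of_coplanar)
    show "independent ?S"
      by (rule independent_mono[OF frame_independent(2)[of n m]]) blast
    show "dim (star r (n+1) (m+1)) \<le> 3"
      by (rule star_coplanar)
    show "?S \<subseteq> star r (n+1) (m+1)" "r (n+2) (m+1) \<in> star r (n+1) (m+1)"
      unfolding star_def n by blast+
  qed (use frame_independent(1)[of n m] in simp)
  then obtain x1 x2 x3 where "r (n+2) (m+1) - x1 *\<^sub>R r (n+1) m - x2 *\<^sub>R r n (m+1) = x3 *\<^sub>R r (n+1) (m+1)"
    unfolding span_breakdown_eq by auto
  then have "r (n+2) (m+1) = frame_vector r n m 0 x1 x2 x3"
    by (simp add: frame_vector_def algebra_simps)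
  moreover note \<beta>_frame_vector[of n m, symmetric]
  ultimately have "\<beta> r n m $ 0 = 0"
    by (simp add: frame_vector_eq_iff)
  with \<beta>_frame_vector[of n m] show ?thesis by simp
qed

text \<open>The next frame is \<open>r\<^sub>1, r\<^sub>1\<^sub>1, r\<^sub>1\<^sub>2,
  r\<^sub>1\<^sub>1\<^sub>2\<close>; inserting the structure equations makes objects of neighbouring
  quadrilaterals comparable.\<close>

lemma frame_vector_next:
  "frame_vector r (n+1) m y0 y1 y2 y3 = frame_vector r n m (\<alpha> r n m $ 0 * y1)
     (y0 + \<alpha> r n m $ 1 * y1 + \<beta> r n m $ 1 * y3) (\<beta> r n m $ 2 * y3)
     (y2 + \<alpha> r n m $ 3 * y1 + \<beta> r n m $ 3 * y3)"
proof -
  have "frame_vector r (n+1) m y0 y1 y2 y3 = y0 *\<^sub>R r (n+1) m + y1 *\<^sub>R r (n+2) m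
      + y2 *\<^sub>R r (n+1) (m+1) + y3 *\<^sub>R r (n+2) (m+1)"
    by (simp add: frame_vector_def add.assoc)
  then show ?thesis
    unfolding r_112[of n m] r_11[of n m] by (simp add: frame_vector_def algebra_simps)
qed

text \<open>The inverse change of frame: the coordinates along \<open>r\<close> and
  \<open>r\<^sub>2\<close> determine those along \<open>r\<^sub>1\<^sub>1\<close> and
  \<open>r\<^sub>1\<^sub>1\<^sub>2\<close>, because \<alpha> 0 and \<beta> 2 do not vanish.\<close>

lemma frame_vector_to_next:
  "frame_vector r n m x0 x1 x2 x3 = frame_vector r (n+1) m
     (x1 - \<alpha> r n m $ 1 * x0 / \<alpha> r n m $ 0 - \<beta> r n m $ 1 * x2 / \<beta> r n m $ 2) (x0 / \<alpha> r n m $ 0)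
     (x3 - \<alpha> r n m $ 3 * x0 / \<alpha> r n m $ 0 - \<beta> r n m $ 3 * x2 / \<beta> r n m $ 2) (x2 / \<beta> r n m $ 2)"
proof -
  have *: "x0 = a0 * (x0 / a0) \<and> x1 = x1 - a1 * x0 / a0 - b1 * x2 / b2 + a1 * (x0 / a0) + b1 * (x2 / b2)
      \<and> x2 = b2 * (x2 / b2) \<and> x3 = x3 - a3 * x0 / a0 - b3 * x2 / b2 + a3 * (x0 / a0) + b3 * (x2 / b2)"
    if "a0 \<noteq> 0" "b2 \<noteq> 0" for a0 a1 a3 b1 b2 b3 :: real
    using that by simp
  show ?thesis
    unfolding frame_vector_next[of n m] frame_vector_eq_iff
    by (rule *) (rule coefficients_nonzero)+
qed

section \<open>Quadrics and tangent planes in frame coordinates\<close>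

lemma quadric_point_frame_vector:
  "quadric_point r p n m (\<sigma>0, \<sigma>1) (\<tau>0, \<tau>1)
     = frame_vector r n m (\<sigma>1 * \<tau>1) (\<sigma>1 * \<tau>0) (\<sigma>0 * \<tau>1) (\<sigma>0 * \<tau>0 * p n m)"
  by (simp add: frame_vector_def)

text \<open>Up to the factor \<open>p\<close>, the coordinates are the products of one \<sigma> and
  one \<tau>, which form a matrix of rank one; its determinant gives the implicit equation.\<close>

lemma quadric_equation:
  assumes "frame_vector r n m x0 x1 x2 x3 \<in> quadric r p n m"
  shows "x0 * x3 = p n m * (x1 * x2)"
proof -
  obtain \<sigma>0 \<sigma>1 \<tau>0 \<tau>1 where
    "frame_vector r n m x0 x1 x2 x3 = quadric_point r p n m (\<sigma>0, \<sigma>1) (\<tau>0, \<tau>1)"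
    using assms unfolding quadric_def mem_Collect_eq split_paired_Ex by metis
  then show ?thesis
    unfolding quadric_point_frame_vector frame_vector_eq_iff by (elim conjE) (hypsubst, simp)
qed

lemma quadric_point_in_tangent_plane:
  "quadric_point r p n m \<sigma>' \<tau> + quadric_point r p n m \<sigma> \<tau>'
     \<in> tangent_plane r p n m (quadric_point r p n m \<sigma> \<tau>)"
  unfolding tangent_plane_def by blast

text \<open>This is the polarisation of the quadric equation: tangent vectors lie in the polar plane
  of the point.\<close>

lemma tangent_plane_equation:
  assumes "frame_vector r n m y0 y1 y2 y3 \<in> tangent_plane r p n m (frame_vector r n m x0 x1 x2 x3)"
  shows "x0 * y3 + x3 * y0 = p n m * (x1 * y2 + x2 * y1)"
proof -
  obtain \<sigma>0 \<sigma>1 \<tau>0 \<tau>1 \<sigma>0' \<sigma>1' \<tau>0' \<tau>1' where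
    x: "quadric_point r p n m (\<sigma>0, \<sigma>1) (\<tau>0, \<tau>1) = frame_vector r n m x0 x1 x2 x3" and
    y: "frame_vector r n m y0 y1 y2 y3 = quadric_point r p n m (\<sigma>0', \<sigma>1') (\<tau>0, \<tau>1)
          + quadric_point r p n m (\<sigma>0, \<sigma>1) (\<tau>0', \<tau>1')"
    using assms unfolding tangent_plane_def mem_Collect_eq split_paired_Ex by metis
  have "frame_vector r n m y0 y1 y2 y3 = frame_vector r n m (\<sigma>1' * \<tau>1 + \<sigma>1 * \<tau>1')
    (\<sigma>1' * \<tau>0 + \<sigma>1 * \<tau>0') (\<sigma>0' * \<tau>1 + \<sigma>0 * \<tau>1') ((\<sigma>0' * \<tau>0 + \<sigma>0 * \<tau>0') * p n m)"
    unfolding y by (simp add: frame_vector_def algebra_simps)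
  then show ?thesis
    using x unfolding quadric_point_frame_vector frame_vector_eq_iff
    by (elim conjE) (hypsubst, simp add: algebra_simps)
qed

text \<open>It suffices to test the C1 condition at one point of the common edge,
  \<open>r\<^sub>1 + p r\<^sub>1\<^sub>2\<close>, with one tangent vector,
  \<open>r + r\<^sub>2\<close>, whose polar equation on the next quadric relates \<open>p\<close>
  and \<open>p\<^sub>1\<close>.\<close>

lemma lattice_Lie_quadrics_p:
  assumes "lattice_Lie_quadrics r p"
  shows "p n m \<noteq> 0" "p n m * p (n+1) m * \<beta> r n m $ 2 = \<alpha> r n m $ 0"
proof -
  show "p n m \<noteq> 0" using assms by (simp add: lattice_Lie_quadrics_def)
  let ?x = "frame_vector r n m 0 1 0 (p n m)" and ?y = "frame_vector r n m 1 0 1 0"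
  have "?x \<noteq> frame_vector r n m 0 0 0 0" unfolding frame_vector_eq_iff by simp
  moreover have "?x = 1 *\<^sub>R r (n+1) m + p n m *\<^sub>R r (n+1) (m+1)"
    by (simp add: frame_vector_def)
  ultimately have "?x \<in> common_edge1 r n m - {0}"
    unfolding common_edge1_def Diff_iff in_span_pair_iff
    by (metis empty_iff frame_vector_def insert_iff scale_zero_left add_0)
  then have "tangent_plane r p n m ?x = tangent_plane r p (n+1) m ?x"
    using assms by (simp add: lattice_Lie_quadrics_def)
  \<comment> \<open>The point has parameters \<open>s = 1\<close>, \<open>t = 0\<close>; varying
    only \<tau>, in the direction \<open>(0, 1)\<close>, produces the tangent vector
    \<open>r + r\<^sub>2\<close>.\<close>
  moreover have "?x = quadric_point r p n m (1, 1) (1, 0)"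
    "?y = quadric_point r p n m (0, 0) (1, 0) + quadric_point r p n m (1, 1) (0, 1)"
    by (simp_all add: frame_vector_def)
  then have "?y \<in> tangent_plane r p n m ?x"
    by (simp only: quadric_point_in_tangent_plane)
  ultimately have "?y \<in> tangent_plane r p (n+1) m ?x" by simp
  from tangent_plane_equation[OF this[unfolded frame_vector_to_next[of n m]]]
  show "p n m * p (n+1) m * \<beta> r n m $ 2 = \<alpha> r n m $ 0"
    using coefficients_nonzero[of n m] by (simp add: field_simps)
qed

end


section \<open>The first lattice direction\<close>

text \<open>The results of this locale concern the first lattice direction. The second one is
  reached by a second interpretation with the transposed net and \<open>s, t\<close>
  exchanged.\<close>

locale enveloped_net =
  fixes r :: net and p s t :: lattice_fun
  assumes net: "discrete_asymptotic_net r"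
    and quadrics: "lattice_Lie_quadrics r p"
    and envelope: "envelope r p s t"
begin

abbreviation (input) "a0 n m \<equiv> \<alpha> r n m $ 0"
abbreviation (input) "a1 n m \<equiv> \<alpha> r n m $ 1"
abbreviation (input) "a3 n m \<equiv> \<alpha> r n m $ 3"
abbreviation (input) "b1 n m \<equiv> \<beta> r n m $ 1"
abbreviation (input) "b2 n m \<equiv> \<beta> r n m $ 2"
abbreviation (input) "b3 n m \<equiv> \<beta> r n m $ 3"
abbreviation (input) "c n m \<equiv> p (n+1) m * b3 n m - a1 n m"
abbreviation (input) "w \<equiv> \<omega> r p s t"

lemmas p_nonzero = lattice_Lie_quadrics_p(1)[OF net quadrics]
lemmas p_next = lattice_Lie_quadrics_p(2)[OF net quadrics]

lemma st_nonzero: "s n m \<noteq> 0" "t n m \<noteq> 0"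
  using envelope by (simp_all add: envelope_def)

lemma dim_edge1: "dim (edge1 w n m) = 2"
  using envelope by (simp add: envelope_def Let_def)

lemma w_frame_vector: "w n m = frame_vector r n m (s n m * t n m) (s n m) (t n m) (p n m)"
  by (simp add: \<omega>_def frame_vector_def)

lemma w_frame_vector_next:
  "w n m = frame_vector r (n+1) m
     (s n m - a1 n m * (s n m * t n m) / a0 n m - b1 n m * t n m / b2 n m) (s n m * t n m / a0 n m)
     (p n m - a3 n m * (s n m * t n m) / a0 n m - b3 n m * t n m / b2 n m) (t n m / b2 n m)"
  unfolding w_frame_vector by (rule frame_vector_to_next[OF net])

lemma w_next_frame_vector:
  "w (n+1) m = frame_vector r n m (a0 n m * s (n+1) m)
     (s (n+1) m * t (n+1) m + a1 n m * s (n+1) m + b1 n m * p (n+1) m) (b2 n m * p (n+1) m)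
     (t (n+1) m + a3 n m * s (n+1) m + b3 n m * p (n+1) m)"
  unfolding w_frame_vector by (rule frame_vector_next[OF net])

lemma w_tangent:
  "w (n+1) m \<in> tangent_plane r p n m (w n m)"
  "w n m \<in> tangent_plane r p (n+1) m (w (n+1) m)"
proof -
  have e: "edge1 w n m \<subseteq> tangent_plane r p n m (w n m)"
    "edge1 w (n-1) m \<subseteq> tangent_plane r p n m (w n m)" for n m
    using envelope by (simp_all add: envelope_def Let_def)
  have "w n m \<in> edge1 w n m" "w (n+1) m \<in> edge1 w n m"
    by (simp_all add: edge1_def span_base)
  \<comment> \<open>The backward edge at \<open>w (n+1) m\<close> is the forward edge at
    \<open>w n m\<close>, so this one edge lies in both tangent planes.\<close>
  with e(1)[of n m] e(2)[of "n+1" m] show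
    "w (n+1) m \<in> tangent_plane r p n m (w n m)"
    "w n m \<in> tangent_plane r p (n+1) m (w (n+1) m)"
    by auto
qed

text \<open>The polar equations of the two tangency conditions, written over one frame each, are
  added and subtracted. The sum is free of both \<open>t\<close>-parameters after division by
  \<open>t n m\<close>.\<close>

lemma contact:
  "2 * a3 n m * s n m * s (n+1) m - 2 * p n m * p (n+1) m * b1 n m
     + (s n m + p n m * s (n+1) m) * c n m = 0" (is ?A)
  "s n m = p n m * s (n+1) m \<or>
     2 * t n m * t (n+1) m = 2 * a0 n m - t n m * (p (n+1) m * b3 n m + a1 n m)" (is ?B)
proof -
  have *: "2 * a3 * s * s1 - 2 * p * p1 * b1 + (s + p * s1) * (p1 * b3 - a1) = 0 \<and>
      (s = p * s1 \<or> 2 * t * t1 = 2 * a0 - t * (p1 * b3 + a1))"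
    if nz: "p \<noteq> 0" "p1 \<noteq> 0" "b2 \<noteq> 0" "t \<noteq> 0" and a0: "p * p1 * b2 = a0"
      and e1: "(s * t) * (t1 + a3 * s1 + b3 * p1) + p * (a0 * s1)
        = p * (s * (b2 * p1) + t * (s1 * t1 + a1 * s1 + b1 * p1))"
      and e2: "(s1 * t1) * (t / b2) + p1 * (s - a1 * (s * t) / a0 - b1 * t / b2)
        = p1 * (s1 * (p - a3 * (s * t) / a0 - b3 * t / b2) + t1 * (s * t / a0))"
    for p p1 a0 a1 a3 b1 b2 b3 s s1 t t1 :: real
  proof -
    \<comment> \<open>This is \<open>e2\<close> multiplied by \<open>a0 * b2\<close>, with
      \<open>a0\<close> replaced by \<open>p * p1 * b2\<close> where needed.\<close>
    have "p1 * b2 * (p * s1 * t1 * t + s * a0 - a1 * s * t - p * p1 * b1 * t)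
      = p1 * b2 * (p * s1 * a0 - a3 * s * s1 * t - p * p1 * b3 * s1 * t + s * t * t1)"
      using e2 nz unfolding a0[symmetric] by (simp add: field_simps)
    then have e2': "p * s1 * t1 * t + s * a0 - a1 * s * t - p * p1 * b1 * t
      = p * s1 * a0 - a3 * s * s1 * t - p * p1 * b3 * s1 * t + s * t * t1"
      using nz by simp
    have e1': "s * t * t1 + a3 * s * s1 * t + b3 * p1 * s * t + p * a0 * s1
      = s * a0 + p * s1 * t * t1 + p * a1 * s1 * t + p * p1 * b1 * t"
      using e1 unfolding a0[symmetric] by (simp add: algebra_simps)
    \<comment> \<open>Sum of \<open>e1'\<close> and \<open>e2'\<close>: the terms with
      \<open>t1\<close> and those with \<open>a0\<close> cancel.\<close>
    have "t * (2 * a3 * s * s1 - 2 * p * p1 * b1 + (s + p * s1) * (p1 * b3 - a1)) = 0"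
      using e1' e2' by (simp add: algebra_simps)
    \<comment> \<open>Difference of \<open>e1'\<close> and \<open>e2'\<close>: here the terms with
      \<open>a3\<close> and \<open>b1\<close> cancel, which allows the factorisation.\<close>
    moreover have "(s - p * s1) * (2 * t * t1 - (2 * a0 - t * (p1 * b3 + a1))) = 0"
      using e1' e2' by (simp add: algebra_simps)
    ultimately show ?thesis using nz by simp
  qed
  show ?A ?B
    using *[OF p_nonzero p_nonzero coefficients_nonzero(4)[OF net] st_nonzero(2) p_next
        tangent_plane_equation[OF net w_tangent(1)[of n m, unfolded w_frame_vector[of n m] w_next_frame_vector]]
        tangent_plane_equation[OF net w_tangent(2)[of n m, unfolded w_frame_vector[of "n+1" m] w_frame_vector_next[of n m]]]]
    by blast+
qed

section \<open>Shared generators and the quadratic equation for their parameter\<close>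

text \<open>The generator of the quadric through \<open>\<omega>\<close> on which the parameter \<open>s\<close> is constant.\<close>

definition w_generator :: "int \<Rightarrow> int \<Rightarrow> (real ^ 4) set" where
  "w_generator n m = span {frame_vector r n m 0 (s n m) 0 (p n m), frame_vector r n m (s n m) 0 1 0}"

lemma in_w_generator_iff:
  "x \<in> w_generator n m \<longleftrightarrow> (\<exists>u v. x = frame_vector r n m (v * s n m) (u * s n m) v (u * p n m))"
  unfolding w_generator_def in_span_pair_iff by (simp add: frame_vector_def algebra_simps)

lemma w_in_w_generator: "w n m \<in> w_generator n m"
  unfolding in_w_generator_iff w_frame_vector
  by (rule exI[of _ 1], rule exI[of _ "t n m"]) (simp add: mult.commute)

text \<open>On the next quadric the only candidate is the generator with parameter
  \<open>s / p\<close>, since it has to pass through the same point of the common edge. The two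
  lines coincide exactly under the quadratic equation \<open>root\<close>.\<close>

lemma w_generator_shared:
  assumes root: "a3 n m * (s n m)\<^sup>2 + p n m * c n m * s n m = (p n m)\<^sup>2 * p (n+1) m * b1 n m"
  shows "shared_generator1 r p n m (w_generator n m)"
proof -
  note nz = p_nonzero[of n m] p_nonzero[of "n+1" m] coefficients_nonzero[OF net, of n m]
    st_nonzero[of n m]
  have "u = 0 \<and> v = 0" if "u *\<^sub>R frame_vector r n m 0 (s n m) 0 (p n m)
      + v *\<^sub>R frame_vector r n m (s n m) 0 1 0 = 0" for u v
  proof -
    have "frame_vector r n m (v * s n m) (u * s n m) v (u * p n m) = frame_vector r n m 0 0 0 0"
      using that by (simp add: frame_vector_def algebra_simps)
    then show ?thesis unfolding frame_vector_eq_iff[OF net] using nz by simp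
  qed
  then have dim: "dim (w_generator n m) = 2"
    unfolding w_generator_def by (rule dim_span_pair)
  have sub: "subspace (w_generator n m)"
    by (simp add: w_generator_def)
  have "x \<in> quadric r p n m \<and> x \<in> quadric r p (n+1) m" if x: "x \<in> w_generator n m" "x \<noteq> 0" for x
  proof
    obtain u v where uv: "x = frame_vector r n m (v * s n m) (u * s n m) v (u * p n m)"
      using x(1) in_w_generator_iff by blast
    have nuv: "u \<noteq> 0 \<or> v \<noteq> 0"
      using x(2) uv zero_frame_vector by auto
    have "x = quadric_point r p n m (1, s n m) (u, v)"
      unfolding uv by (simp add: frame_vector_def mult.commute)
    moreover have "(u, v) \<noteq> (0, 0)" "(1::real, s n m) \<noteq> (0, 0)"
      using nuv by auto
    ultimately show "x \<in> quadric r p n m"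
      unfolding quadric_def by blast
    \<comment> \<open>Parameters of \<open>x\<close> on the next quadric: \<sigma> comes from the
      common point on the edge, \<open>\<tau>0\<close> from the coordinate of \<open>x\<close> along
      \<open>r\<^sub>2\<close>, and \<open>\<tau>1\<close> from the one along
      \<open>r\<^sub>1\<^sub>2\<close>.\<close>
    define \<sigma> where "\<sigma> = s n m / p n m"
    define \<tau>0 where "\<tau>0 = v / (b2 n m * p (n+1) m)"
    define \<tau>1 where "\<tau>1 = u * p n m - (a3 n m * \<sigma> + b3 n m * p (n+1) m) * \<tau>0"
    have s: "s n m = p n m * \<sigma>" and v: "v = b2 n m * p (n+1) m * \<tau>0"
      using nz by (simp_all add: \<sigma>_def \<tau>0_def)
    have "(p n m)\<^sup>2 * (a3 n m * \<sigma>\<^sup>2 + c n m * \<sigma>) = (p n m)\<^sup>2 * (p (n+1) m * b1 n m)"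
      using root unfolding s by (simp add: algebra_simps power2_eq_square)
    then have root': "a3 n m * \<sigma>\<^sup>2 + c n m * \<sigma> = p (n+1) m * b1 n m"
      using nz by simp
    have "x = frame_vector r (n+1) m (\<sigma> * \<tau>1) (\<sigma> * \<tau>0) \<tau>1 (\<tau>0 * p (n+1) m)"
      unfolding uv frame_vector_next[OF net] frame_vector_eq_iff[OF net]
    proof (intro conjI)
      show "v * s n m = a0 n m * (\<sigma> * \<tau>0)"
        unfolding p_next[symmetric] s v by simp
      \<comment> \<open>The coordinate along \<open>r\<^sub>1\<close> is the one that still imposes
        a condition, and that condition is \<open>root'\<close>.\<close>
      have "\<tau>0 * (a3 n m * \<sigma>\<^sup>2 + c n m * \<sigma>) = \<tau>0 * (p (n+1) m * b1 n m)"
        unfolding root' ..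
      then show "u * s n m = \<sigma> * \<tau>1 + a1 n m * (\<sigma> * \<tau>0) + b1 n m * (\<tau>0 * p (n+1) m)"
        unfolding \<tau>1_def s by (simp add: algebra_simps power2_eq_square)
      show "v = b2 n m * (\<tau>0 * p (n+1) m)"
        unfolding v by simp
      show "u * p n m = \<tau>1 + a3 n m * (\<sigma> * \<tau>0) + b3 n m * (\<tau>0 * p (n+1) m)"
        unfolding \<tau>1_def by (simp add: algebra_simps)
    qed
    then have "x = quadric_point r p (n+1) m (1, \<sigma>) (\<tau>0, \<tau>1)"
      by (simp add: frame_vector_def)
    moreover have "(1::real, \<sigma>) \<noteq> (0, 0)" by simp
    moreover have "(\<tau>0, \<tau>1) \<noteq> (0, 0)"
    proof
      assume "(\<tau>0, \<tau>1) = (0, 0)"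
      then have "\<tau>0 = 0" "\<tau>1 = 0" by simp_all
      then have "v = 0" "u * p n m = 0" using v unfolding \<tau>1_def by simp_all
      then have "v = 0" "u = 0" using nz by simp_all
      then show False using nuv by simp
    qed
    ultimately show "x \<in> quadric r p (n+1) m"
      unfolding quadric_def by blast
  qed
  \<comment> \<open>Transversality: the generator meets the common edge only in the point
    \<open>s r\<^sub>1 + p r\<^sub>1\<^sub>2\<close>.\<close>
  moreover have "w_generator n m \<inter> common_edge1 r n m = span {frame_vector r n m 0 (s n m) 0 (p n m)}"
  proof (intro equalityI subsetI)
    fix x assume x: "x \<in> w_generator n m \<inter> common_edge1 r n m"
    then obtain k l where "x = k *\<^sub>R r (n+1) m + l *\<^sub>R r (n+1) (m+1)"
      unfolding common_edge1_def Int_iff in_span_pair_iff by blast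
    then have "x = frame_vector r n m 0 k 0 l"
      by (simp add: frame_vector_def)
    moreover obtain u v where uv: "x = frame_vector r n m (v * s n m) (u * s n m) v (u * p n m)"
      using x in_w_generator_iff by blast
    ultimately have "v = 0" by (simp add: frame_vector_eq_iff[OF net])
    then have "x = u *\<^sub>R frame_vector r n m 0 (s n m) 0 (p n m)"
      unfolding uv by (simp add: frame_vector_def algebra_simps)
    then show "x \<in> span {frame_vector r n m 0 (s n m) 0 (p n m)}"
      by (simp add: span_base span_scale)
  next
    fix x assume "x \<in> span {frame_vector r n m 0 (s n m) 0 (p n m)}"
    then obtain u where u: "x = u *\<^sub>R frame_vector r n m 0 (s n m) 0 (p n m)"
      by (auto simp: span_singleton)
    then have "x = frame_vector r n m (0 * s n m) (u * s n m) 0 (u * p n m)"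
      by (simp add: frame_vector_def algebra_simps)
    then have "x \<in> w_generator n m"
      unfolding in_w_generator_iff by blast
    moreover have "x = (u * s n m) *\<^sub>R r (n+1) m + (u * p n m) *\<^sub>R r (n+1) (m+1)"
      unfolding u by (simp add: frame_vector_def algebra_simps)
    then have "x \<in> common_edge1 r n m"
      unfolding common_edge1_def in_span_pair_iff by blast
    ultimately show "x \<in> w_generator n m \<inter> common_edge1 r n m" by simp
  qed
  moreover have "frame_vector r n m 0 (s n m) 0 (p n m) \<noteq> 0"
    using nz frame_vector_eq_iff[OF net, of n m 0 "s n m" 0 "p n m" 0 0 0 0]
    by (simp add: zero_frame_vector)
  ultimately show ?thesis
    unfolding shared_generator1_def shared_generator_def generator_def
    using dim sub by (auto simp: dim_singleton)
qed

text \<open>The assumption puts both vertices on generators through the same point of the common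
  edge, and the bilinear relation degenerates to the quadratic one, so these generators coincide
  with the edge. This is the case excluded later.\<close>

lemma edge1_eq_w_generator:
  assumes "s n m = p n m * s (n+1) m"
  shows "edge1 w n m = w_generator n m" and "shared_generator1 r p n m (edge1 w n m)"
proof -
  note nz = p_nonzero[of n m] p_nonzero[of "n+1" m] coefficients_nonzero[OF net, of n m]
    st_nonzero[of "n+1" m]
  have "2 * (p n m * (a3 n m * (s (n+1) m)\<^sup>2 + c n m * s (n+1) m)) = 2 * (p n m * (p (n+1) m * b1 n m))"
    using contact(1)[of n m] unfolding assms by (simp add: algebra_simps power2_eq_square)
  then have root': "a3 n m * (s (n+1) m)\<^sup>2 + c n m * s (n+1) m = p (n+1) m * b1 n m"
    using nz by simp
  then have "(p n m)\<^sup>2 * (a3 n m * (s (n+1) m)\<^sup>2 + c n m * s (n+1) m) = (p n m)\<^sup>2 * (p (n+1) m * b1 n m)"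
    by simp
  then have root: "a3 n m * (s n m)\<^sup>2 + p n m * c n m * s n m = (p n m)\<^sup>2 * p (n+1) m * b1 n m"
    unfolding assms by (simp add: algebra_simps power2_eq_square)
  note shared = w_generator_shared[OF root]
  \<comment> \<open>The coefficient of \<open>w (n+1) m\<close> in \<open>w_generator n m\<close>,
    read off along \<open>r\<^sub>1\<^sub>2\<close>; the other one,
    \<open>b2 n m * p (n+1) m\<close>, is read off along \<open>r\<^sub>2\<close>.\<close>
  define u where "u = (t (n+1) m + a3 n m * s (n+1) m + b3 n m * p (n+1) m) / p n m"
  have u: "u * p n m = t (n+1) m + a3 n m * s (n+1) m + b3 n m * p (n+1) m"
    using nz by (simp add: u_def)
  have "u * s n m = (u * p n m) * s (n+1) m"
    unfolding assms by simp
  also have "\<dots> = s (n+1) m * t (n+1) m + a1 n m * s (n+1) m + b1 n m * p (n+1) m"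
    using root' unfolding u by (simp add: algebra_simps power2_eq_square)
  finally have "w (n+1) m
      = frame_vector r n m (b2 n m * p (n+1) m * s n m) (u * s n m) (b2 n m * p (n+1) m) (u * p n m)"
    unfolding w_next_frame_vector u frame_vector_eq_iff[OF net] p_next[symmetric] assms by simp
  then have "w (n+1) m \<in> w_generator n m"
    unfolding in_w_generator_iff by blast
  then have "edge1 w n m \<subseteq> w_generator n m"
    unfolding edge1_def using w_in_w_generator[of n m]
    by (intro span_minimal) (auto simp: w_generator_def)
  then show eq: "edge1 w n m = w_generator n m"
    using dim_edge1[of n m] shared
    unfolding shared_generator1_def shared_generator_def generator_def
    by (intro subspace_dim_equal) (auto simp: edge1_def)
  show "shared_generator1 r p n m (edge1 w n m)"
    using shared unfolding eq .
qed

text \<open>Converse of \<open>w_generator_shared\<close>, for an arbitrary shared generator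
  \<open>g\<close>: its point \<open>e\<close> on the common edge is forced by the first quadric,
  and a further point of \<open>g\<close> is then tested on the second.\<close>

lemma shared_generator_through_w:
  assumes "shared_generator1 r p n m g" "w n m \<in> g"
  shows "a3 n m * (s n m)\<^sup>2 + p n m * c n m * s n m = (p n m)\<^sup>2 * p (n+1) m * b1 n m"
proof -
  note nz = p_nonzero[of n m] p_nonzero[of "n+1" m] coefficients_nonzero[OF net, of n m]
    st_nonzero[of n m]
  have Q: "x \<in> quadric r p n m" "x \<in> quadric r p (n+1) m"
    if "x \<in> g" "x \<noteq> 0" for x
    using assms(1) that unfolding shared_generator1_def shared_generator_def generator_def by auto
  have sub: "subspace g" and "dim (g \<inter> common_edge1 r n m) = 1"
    using assms(1) unfolding shared_generator1_def shared_generator_def generator_def by auto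
  then have "\<not> g \<inter> common_edge1 r n m \<subseteq> {0}"
    by (metis dim_eq_0 zero_neq_one)
  then obtain e where e: "e \<in> g" "e \<in> common_edge1 r n m" "e \<noteq> 0" by blast
  then obtain k l where kl: "e = k *\<^sub>R r (n+1) m + l *\<^sub>R r (n+1) (m+1)"
    unfolding common_edge1_def in_span_pair_iff by blast
  \<comment> \<open>Since \<open>w n m\<close> and \<open>e\<close> lie on the quadric, membership
    of their sum is the polar equation; it fixes the ratio of \<open>k\<close> and
    \<open>l\<close>.\<close>
  let ?x = "w n m + e"
  have x: "?x = frame_vector r n m (s n m * t n m) (s n m + k) (t n m) (p n m + l)"
    unfolding w_frame_vector kl by (simp add: frame_vector_def algebra_simps)
  have "?x \<in> g" using sub assms(2) e(1) by (rule subspace_add)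
  moreover have "?x \<noteq> 0"
    using nz frame_vector_eq_iff[OF net, of n m "s n m * t n m" "s n m + k" "t n m" "p n m + l" 0 0 0 0]
    by (auto simp: x zero_frame_vector)
  ultimately have "?x \<in> quadric r p n m" by (rule Q(1))
  from quadric_equation[OF net this[unfolded x]]
  have "t n m * (s n m * l) = t n m * (p n m * k)" by (simp add: algebra_simps)
  then have k: "k = s n m * l / p n m" and l: "l \<noteq> 0"
    using nz kl e(3) by (auto simp: field_simps)
  \<comment> \<open>The point of \<open>g\<close> on the line through \<open>r\<close> and
    \<open>r\<^sub>2\<close>; its equation on the next quadric is the quadratic equation for
    \<open>s\<close>.\<close>
  let ?y = "w n m + (- p n m / l) *\<^sub>R e"
  have y: "?y = frame_vector r n m (s n m * t n m) 0 (t n m) 0"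
    unfolding w_frame_vector kl k using l nz by (simp add: frame_vector_def algebra_simps)
  have "?y \<in> g" using sub assms(2) e(1) by (intro subspace_add subspace_scale)
  moreover have "?y \<noteq> 0"
    using nz frame_vector_eq_iff[OF net, of n m "s n m * t n m" 0 "t n m" 0 0 0 0 0]
    unfolding y zero_frame_vector by simp
  ultimately have "?y \<in> quadric r p (n+1) m" by (rule Q(2))
  from quadric_equation[OF net this[unfolded y frame_vector_to_next[OF net, of n m]]]
  have eq: "(0 - a1 n m * (s n m * t n m) / a0 n m - b1 n m * t n m / b2 n m) * (t n m / b2 n m)
    = p (n+1) m * (s n m * t n m / a0 n m
        * (0 - a3 n m * (s n m * t n m) / a0 n m - b3 n m * t n m / b2 n m))" .
  have *: "a3 * s\<^sup>2 + p * (p1 * b3 - a1) * s = p\<^sup>2 * p1 * b1"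
    if nz: "p \<noteq> 0" "p1 \<noteq> 0" "b2 \<noteq> 0" "t \<noteq> 0" and a0: "p * p1 * b2 = a0"
      and eq: "(0 - a1 * (s * t) / a0 - b1 * t / b2) * (t / b2)
        = p1 * (s * t / a0 * (0 - a3 * (s * t) / a0 - b3 * t / b2))"
    for p p1 a0 a1 a3 b1 b2 b3 s t :: real
  proof -
    have 1: "0 - a1 * (s * t) / a0 - b1 * t / b2 = t / b2 * (- a1 * s / (p * p1) - b1)"
      "0 - a3 * (s * t) / a0 - b3 * t / b2 = t / b2 * (- a3 * s / (p * p1) - b3)"
      "p1 * (s * t / a0 * k) = (t / b2) * (s / p * k)" for k
      using nz unfolding a0[symmetric] by (simp_all add: field_simps)
    have "(t / b2) * (t / b2) * (- a1 * s / (p * p1) - b1 - s / p * (- a3 * s / (p * p1) - b3)) = 0"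
      using eq unfolding 1 by (simp add: algebra_simps)
    then have "- a1 * s / (p * p1) - b1 = s / p * (- a3 * s / (p * p1) - b3)"
      using nz by simp
    then have "p * p1 * (a3 * s\<^sup>2 + p * (p1 * b3 - a1) * s) = p * p1 * (p\<^sup>2 * p1 * b1)"
      using nz by (simp add: field_simps power2_eq_square)
    then show ?thesis using nz by simp
  qed
  show ?thesis
    by (rule *[OF nz(1,2,6,8) p_next eq])
qed

text \<open>With \<alpha> 0 eliminated by \<open>p_next\<close>, \<open>D1\<close> is, up to a
  nonzero square, the discriminant of the quadratic equation in
  \<open>w_generator_shared\<close>.\<close>

lemma D1_eq: "D1 r p n m = (p n m * b2 n m)\<^sup>2 * ((c n m)\<^sup>2 + 4 * p (n+1) m * b1 n m * a3 n m)"
  unfolding D1_def p_next[symmetric] by (simp add: algebra_simps power2_eq_square)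

end

section \<open>Discriminant and intersection criteria when edges are not shared generators\<close>

locale unshared_envelope = enveloped_net +
  assumes no_shared_edge: "\<not> shared_generator1 r p n m (edge1 (\<omega> r p s t) n m)"
begin

text \<open>The other alternative in \<open>contact\<close> would make the edge a shared
  generator.\<close>

lemma t_next: "2 * t n m * t (n+1) m = 2 * a0 n m - t n m * (p (n+1) m * b3 n m + a1 n m)"
  using contact(2) edge1_eq_w_generator(2) no_shared_edge by blast

text \<open>Multiplying the bilinear relation by \<open>2 * a3 n m\<close> and completing it to a
  product of two linear factors leaves the discriminant as the constant term.\<close>

lemma D1_eq_0_iff:
  "D1 r p n m = 0 \<longleftrightarrow> 2 * a3 n m * s (n+1) m + c n m = 0 \<or> 2 * a3 n m * s n m + p n m * c n m = 0"
proof -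
  have "(2 * a3 n m * s (n+1) m + c n m) * (2 * a3 n m * s n m + p n m * c n m)
    = p n m * ((c n m)\<^sup>2 + 4 * p (n+1) m * b1 n m * a3 n m)
      + 2 * a3 n m * (2 * a3 n m * s n m * s (n+1) m - 2 * p n m * p (n+1) m * b1 n m
          + (s n m + p n m * s (n+1) m) * c n m)"
    by (simp add: algebra_simps power2_eq_square)
  then have "(2 * a3 n m * s (n+1) m + c n m) * (2 * a3 n m * s n m + p n m * c n m)
    = p n m * ((c n m)\<^sup>2 + 4 * p (n+1) m * b1 n m * a3 n m)"
    unfolding contact(1) by simp
  then have "(c n m)\<^sup>2 + 4 * p (n+1) m * b1 n m * a3 n m = 0 \<longleftrightarrow>
      (2 * a3 n m * s (n+1) m + c n m) * (2 * a3 n m * s n m + p n m * c n m) = 0"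
    using p_nonzero[of n m] by simp
  then show ?thesis
    unfolding D1_eq using p_nonzero[of n m] coefficients_nonzero(4)[OF net, of n m] by simp
qed

text \<open>The meeting criterion in the frame at \<open>(n, m)\<close> compares the coordinates
  along \<open>r\<^sub>2\<close> and \<open>r\<^sub>1\<^sub>2\<close>; \<open>t_next\<close> then
  eliminates \<open>t (n+1) m\<close>.\<close>

lemma L_meet_iff:
  "L r w n m \<inter> L r w (n+1) m \<noteq> {0} \<longleftrightarrow> 2 * a3 n m * s (n+1) m + c n m = 0"
proof -
  note nz = p_nonzero[of n m] p_nonzero[of "n+1" m] coefficients_nonzero[OF net, of n m]
    st_nonzero[of n m]
  have "L r w n m \<inter> L r w (n+1) m \<noteq> {0} \<longleftrightarrow>
      t n m * (t (n+1) m + a3 n m * s (n+1) m + b3 n m * p (n+1) m) = p n m * (b2 n m * p (n+1) m)"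
    unfolding L_def
    by (rule lines_meet_iff[OF frame_independent[OF net]
          w_frame_vector[unfolded frame_vector_def] w_next_frame_vector[unfolded frame_vector_def]])
      (use nz in simp_all)
  also have "\<dots> \<longleftrightarrow> t n m * (2 * a3 n m * s (n+1) m + c n m) = 0"
    using t_next[of n m] unfolding p_next[of n m, symmetric] by (auto simp: algebra_simps)
  finally show ?thesis using nz by simp
qed

text \<open>Now the coordinates along \<open>r\<close> and \<open>r\<^sub>1\<close> are compared.
  The resulting condition differs from that for \<open>L\<close>, and only the bilinear relation
  identifies the two.\<close>

lemma L2_meet_iff:
  "L2 r w n m \<inter> L2 r w (n+1) m \<noteq> {0} \<longleftrightarrow> 2 * a3 n m * s (n+1) m + c n m = 0"
proof -
  note nz = p_nonzero[of n m] p_nonzero[of "n+1" m] coefficients_nonzero[OF net, of n m]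
    st_nonzero[of n m] st_nonzero[of "n+1" m]
  have "L2 r w n m \<inter> L2 r w (n+1) m \<noteq> {0} \<longleftrightarrow>
      (s n m * t n m) * (s (n+1) m * t (n+1) m + a1 n m * s (n+1) m + b1 n m * p (n+1) m)
      = s n m * (a0 n m * s (n+1) m)"
    unfolding L2_def
  proof (rule lines_meet_iff)
    show "distinct [r n (m+1), r (n+1) (m+1), r n m, r (n+1) m]"
      "independent {r n (m+1), r (n+1) (m+1), r n m, r (n+1) m}"
      using frame_independent[OF net, of n m] by (auto simp: insert_commute)
    show "w n m = t n m *\<^sub>R r n (m+1) + p n m *\<^sub>R r (n+1) (m+1)
        + (s n m * t n m) *\<^sub>R r n m + s n m *\<^sub>R r (n+1) m"
      unfolding w_frame_vector by (simp add: frame_vector_def)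
    show "w (n+1) m = (b2 n m * p (n+1) m) *\<^sub>R r n (m+1)
        + (t (n+1) m + a3 n m * s (n+1) m + b3 n m * p (n+1) m) *\<^sub>R r (n+1) (m+1)
        + (a0 n m * s (n+1) m) *\<^sub>R r n m
        + (s (n+1) m * t (n+1) m + a1 n m * s (n+1) m + b1 n m * p (n+1) m) *\<^sub>R r (n+1) m"
      unfolding w_next_frame_vector by (simp add: frame_vector_def)
  qed (use nz in simp_all)
  also have "\<dots> \<longleftrightarrow> 2 * (t n m * (s (n+1) m * t (n+1) m + a1 n m * s (n+1) m + b1 n m * p (n+1) m))
      = 2 * a0 n m * s (n+1) m"
    using nz by (simp add: mult.assoc)
  also have "2 * (t n m * (s (n+1) m * t (n+1) m + a1 n m * s (n+1) m + b1 n m * p (n+1) m))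
      = s (n+1) m * (2 * t n m * t (n+1) m)
        + 2 * t n m * (a1 n m * s (n+1) m + b1 n m * p (n+1) m)"
    by (simp add: algebra_simps)
  also have "\<dots> = 2 * a0 n m * s (n+1) m \<longleftrightarrow>
      t n m * (2 * p (n+1) m * b1 n m - s (n+1) m * c n m) = 0"
    unfolding t_next by (auto simp: algebra_simps)
  also have "\<dots> \<longleftrightarrow> p n m * (2 * p (n+1) m * b1 n m - s (n+1) m * c n m) = 0"
    using nz by simp
  \<comment> \<open>After multiplication by \<open>p n m\<close>, the bilinear relation trades the
    term with \<open>b1\<close> for the factor known from \<open>L\<close>.\<close>
  also have "p n m * (2 * p (n+1) m * b1 n m - s (n+1) m * c n m)
      = s n m * (2 * a3 n m * s (n+1) m + c n m)"
    using contact(1)[of n m] by (simp add: algebra_simps)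
  finally show ?thesis using nz by simp
qed

text \<open>The second line passes through \<open>r\<^sub>1\<^sub>1\<close>, so the frame at
  \<open>(n+1, m)\<close> is used, in which \<open>r\<^sub>1\<close> and
  \<open>r\<^sub>1\<^sub>1\<close> are both basis vectors.\<close>

lemma L1_meet_iff:
  "L1 r w n m \<inter> L1 r w (n+1) m \<noteq> {0} \<longleftrightarrow> 2 * a3 n m * s n m + p n m * c n m = 0"
proof -
  note nz = p_nonzero[of n m] p_nonzero[of "n+1" m] coefficients_nonzero[OF net, of n m]
    st_nonzero[of n m] st_nonzero[of "n+1" m]
  have "L1 r w n m \<inter> L1 r w (n+1) m \<noteq> {0} \<longleftrightarrow>
      (t n m / b2 n m) * t (n+1) m
      = (p n m - a3 n m * (s n m * t n m) / a0 n m - b3 n m * t n m / b2 n m) * p (n+1) m"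
    unfolding L1_def
  proof (rule lines_meet_iff)
    show "distinct [r (n+1) m, r (n+1+1) m, r (n+1+1) (m+1), r (n+1) (m+1)]"
      "independent {r (n+1) m, r (n+1+1) m, r (n+1+1) (m+1), r (n+1) (m+1)}"
      using frame_independent[OF net, of "n+1" m] by (auto simp: insert_commute)
    show "w n m = (s n m - a1 n m * (s n m * t n m) / a0 n m - b1 n m * t n m / b2 n m) *\<^sub>R r (n+1) m
        + (s n m * t n m / a0 n m) *\<^sub>R r (n+1+1) m + (t n m / b2 n m) *\<^sub>R r (n+1+1) (m+1)
        + (p n m - a3 n m * (s n m * t n m) / a0 n m - b3 n m * t n m / b2 n m) *\<^sub>R r (n+1) (m+1)"
      unfolding w_frame_vector_next by (simp add: frame_vector_def)
    show "w (n+1) m = (s (n+1) m * t (n+1) m) *\<^sub>R r (n+1) m + s (n+1) m *\<^sub>R r (n+1+1) m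
        + p (n+1) m *\<^sub>R r (n+1+1) (m+1) + t (n+1) m *\<^sub>R r (n+1) (m+1)"
      unfolding w_frame_vector by (simp add: frame_vector_def)
  qed (use nz in simp_all)
  \<comment> \<open>This multiplier, together with \<open>p (n+1) m\<close>, makes up \<alpha> 0 by
    \<open>p_next\<close>, so all denominators cancel.\<close>
  also have "\<dots> \<longleftrightarrow> (p n m * b2 n m) * ((t n m / b2 n m) * t (n+1) m) = (p n m * b2 n m)
      * ((p n m - a3 n m * (s n m * t n m) / a0 n m - b3 n m * t n m / b2 n m) * p (n+1) m)"
    by (rule mult_left_cancel[symmetric]) (use nz in simp)
  also have "(p n m * b2 n m) * ((t n m / b2 n m) * t (n+1) m) = p n m * t n m * t (n+1) m"
    using nz by simp
  also have "(p n m * b2 n m)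
      * ((p n m - a3 n m * (s n m * t n m) / a0 n m - b3 n m * t n m / b2 n m) * p (n+1) m)
      = (p n m * p (n+1) m * b2 n m) * p n m
        - (p n m * p (n+1) m * b2 n m) * (a3 n m * (s n m * t n m) / a0 n m)
        - p n m * p (n+1) m * (b2 n m * (b3 n m * t n m / b2 n m))"
    by (simp only: left_diff_distrib right_diff_distrib ac_simps)
  also have "\<dots> = p n m * a0 n m - a3 n m * s n m * t n m - p n m * p (n+1) m * b3 n m * t n m"
    unfolding p_next using nz by simp
  also have "p n m * t n m * t (n+1) m
      = p n m * a0 n m - a3 n m * s n m * t n m - p n m * p (n+1) m * b3 n m * t n m
    \<longleftrightarrow> p n m * (2 * t n m * t (n+1) m)
      = 2 * (p n m * a0 n m - a3 n m * s n m * t n m - p n m * p (n+1) m * b3 n m * t n m)"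
    by auto
  also have "\<dots> \<longleftrightarrow> t n m * (2 * a3 n m * s n m + p n m * c n m) = 0"
    unfolding t_next by (auto simp: algebra_simps)
  finally show ?thesis using nz by simp
qed

text \<open>Again in the frame at \<open>(n+1, m)\<close>, now comparing the coordinates along
  \<open>r\<^sub>1\<^sub>1\<close> and \<open>r\<^sub>1\<close>. As for \<open>L2\<close>, both
  contact relations are needed.\<close>

lemma L12_meet_iff:
  "L12 r w n m \<inter> L12 r w (n+1) m \<noteq> {0} \<longleftrightarrow> 2 * a3 n m * s n m + p n m * c n m = 0"
proof -
  note nz = p_nonzero[of n m] p_nonzero[of "n+1" m] coefficients_nonzero[OF net, of n m]
    st_nonzero[of n m] st_nonzero[of "n+1" m]
  have "L12 r w n m \<inter> L12 r w (n+1) m \<noteq> {0} \<longleftrightarrow>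
      (s n m * t n m / a0 n m) * (s (n+1) m * t (n+1) m)
      = (s n m - a1 n m * (s n m * t n m) / a0 n m - b1 n m * t n m / b2 n m) * s (n+1) m"
    unfolding L12_def
  proof (rule lines_meet_iff)
    show "distinct [r (n+1) (m+1), r (n+1+1) (m+1), r (n+1+1) m, r (n+1) m]"
      "independent {r (n+1) (m+1), r (n+1+1) (m+1), r (n+1+1) m, r (n+1) m}"
      using frame_independent[OF net, of "n+1" m] by (auto simp: insert_commute)
    show "w n m = (p n m - a3 n m * (s n m * t n m) / a0 n m - b3 n m * t n m / b2 n m) *\<^sub>R r (n+1) (m+1)
        + (t n m / b2 n m) *\<^sub>R r (n+1+1) (m+1) + (s n m * t n m / a0 n m) *\<^sub>R r (n+1+1) m
        + (s n m - a1 n m * (s n m * t n m) / a0 n m - b1 n m * t n m / b2 n m) *\<^sub>R r (n+1) m"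
      unfolding w_frame_vector_next by (simp add: frame_vector_def)
    show "w (n+1) m = t (n+1) m *\<^sub>R r (n+1) (m+1) + p (n+1) m *\<^sub>R r (n+1+1) (m+1)
        + s (n+1) m *\<^sub>R r (n+1+1) m + (s (n+1) m * t (n+1) m) *\<^sub>R r (n+1) m"
      unfolding w_frame_vector by (simp add: frame_vector_def)
  qed (use nz in simp_all)
  also have "\<dots> \<longleftrightarrow> a0 n m * ((s n m * t n m / a0 n m) * (s (n+1) m * t (n+1) m)) = a0 n m
      * ((s n m - a1 n m * (s n m * t n m) / a0 n m - b1 n m * t n m / b2 n m) * s (n+1) m)"
    by (rule mult_left_cancel[symmetric]) (use nz in simp)
  also have "a0 n m * ((s n m * t n m / a0 n m) * (s (n+1) m * t (n+1) m))
      = s (n+1) m * (s n m * t n m * t (n+1) m)"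
    using nz by simp
  also have "a0 n m
      * ((s n m - a1 n m * (s n m * t n m) / a0 n m - b1 n m * t n m / b2 n m) * s (n+1) m)
      = s (n+1) m * (s n m * a0 n m - a1 n m * s n m * t n m - a0 n m / b2 n m * b1 n m * t n m)"
    using nz by (simp add: algebra_simps)
  also have "a0 n m / b2 n m = p n m * p (n+1) m"
    unfolding p_next[symmetric] using nz by simp
  also have "s (n+1) m * (s n m * t n m * t (n+1) m) = s (n+1) m
      * (s n m * a0 n m - a1 n m * s n m * t n m - p n m * p (n+1) m * b1 n m * t n m)
    \<longleftrightarrow> s n m * t n m * t (n+1) m
      = s n m * a0 n m - a1 n m * s n m * t n m - p n m * p (n+1) m * b1 n m * t n m"
    using nz by simp
  also have "\<dots> \<longleftrightarrow> s n m * (2 * t n m * t (n+1) m)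
      = 2 * (s n m * a0 n m - a1 n m * s n m * t n m - p n m * p (n+1) m * b1 n m * t n m)"
    by auto
  also have "\<dots> \<longleftrightarrow> t n m * (s n m * c n m - 2 * p n m * p (n+1) m * b1 n m) = 0"
    unfolding t_next by (auto simp: algebra_simps)
  \<comment> \<open>The bilinear relation, solved for the terms without \<open>s (n+1) m\<close>,
    brings out the factor known from \<open>L1\<close>.\<close>
  also have "s n m * c n m - 2 * p n m * p (n+1) m * b1 n m
      = - s (n+1) m * (2 * a3 n m * s n m + p n m * c n m)"
    using contact(1)[of n m] by (simp add: algebra_simps)
  finally show ?thesis using nz by simp
qed

text \<open>For vanishing discriminant the quadratic equation has a double root, so
  \<open>w n m\<close> lies on a shared generator exactly when \<open>s n m\<close> is that
  root.\<close>

lemma shared_generator_through_w_iff: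
  assumes "D1 r p n m = 0"
  shows "(\<exists>g. shared_generator1 r p n m g \<and> w n m \<in> g) \<longleftrightarrow> 2 * a3 n m * s n m + p n m * c n m = 0"
proof -
  have disc: "(c n m)\<^sup>2 + 4 * p (n+1) m * b1 n m * a3 n m = 0"
    using assms p_nonzero[of n m] coefficients_nonzero(4)[OF net, of n m] unfolding D1_eq by simp
  have "(2 * a3 n m * s n m + p n m * c n m)\<^sup>2
    = 4 * a3 n m * (a3 n m * (s n m)\<^sup>2 + p n m * c n m * s n m - (p n m)\<^sup>2 * p (n+1) m * b1 n m)
      + (p n m)\<^sup>2 * ((c n m)\<^sup>2 + 4 * p (n+1) m * b1 n m * a3 n m)"
    by (simp add: algebra_simps power2_eq_square)
  then have sq: "(2 * a3 n m * s n m + p n m * c n m)\<^sup>2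
    = 4 * a3 n m * (a3 n m * (s n m)\<^sup>2 + p n m * c n m * s n m - (p n m)\<^sup>2 * p (n+1) m * b1 n m)"
    unfolding disc by simp
  have "2 * a3 n m * s n m + p n m * c n m = 0 \<longleftrightarrow> (2 * a3 n m * s n m + p n m * c n m)\<^sup>2 = 0"
    by simp
  also have "\<dots> \<longleftrightarrow>
      a3 n m * (s n m)\<^sup>2 + p n m * c n m * s n m = (p n m)\<^sup>2 * p (n+1) m * b1 n m"
    unfolding sq using coefficients_nonzero(2)[OF net, of n m] by simp
  finally show ?thesis
    using shared_generator_through_w w_generator_shared w_in_w_generator by blast
qed

lemma intersection_property1_imp_D1:
  assumes "l \<in> {L r w, L1 r w, L2 r w, L12 r w}" "intersection_property1 l"
  shows "D1 r p n m = 0"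
  using assms unfolding intersection_property1_def D1_eq_0_iff
  by (auto simp: L_meet_iff L1_meet_iff L2_meet_iff L12_meet_iff)

text \<open>A vanishing product only gives one vanishing factor at each place. The geometric reading
  of the second factor makes it subject to homogeneity, so the choice of factor cannot vary over the
  lattice.\<close>

lemma D1_imp_intersection_property1:
  assumes D1: "\<And>n m. D1 r p n m = 0"
    and hom: "homogeneous (\<lambda>n m. \<exists>g. shared_generator1 r p n m g \<and> w n m \<in> g)"
  shows "intersection_property1 (L r w) \<and> intersection_property1 (L2 r w)
       \<or> intersection_property1 (L1 r w) \<and> intersection_property1 (L12 r w)"
proof -
  have "homogeneous (\<lambda>n m. 2 * a3 n m * s n m + p n m * c n m = 0)"
    using hom unfolding shared_generator_through_w_iff[OF D1] .
  then have "(\<forall>n m. 2 * a3 n m * s n m + p n m * c n m = 0) \<or>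
      (\<forall>n m. 2 * a3 n m * s (n+1) m + c n m = 0)"
    using D1 unfolding D1_eq_0_iff homogeneous_def by blast
  then show ?thesis
    unfolding intersection_property1_def L_meet_iff L1_meet_iff L2_meet_iff L12_meet_iff by blast
qed

end


section \<open>Interchanging the lattice directions\<close>

text \<open>Under this exchange \<open>r\<^sub>1\<close> and \<open>r\<^sub>2\<close> swap, hence
  also the two families of generators and the parameters \<open>s\<close> and
  \<open>t\<close>.\<close>

definition transpose_lattice :: "(int \<Rightarrow> int \<Rightarrow> 'a) \<Rightarrow> int \<Rightarrow> int \<Rightarrow> 'a" where
  "transpose_lattice f n m = f m n"

lemma quadric_point_transpose:
  "quadric_point (transpose_lattice r) (transpose_lattice p) n m \<sigma> \<tau> = quadric_point r p m n \<tau> \<sigma>"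
  by (cases \<sigma>; cases \<tau>) (simp add: transpose_lattice_def mult.commute add.commute add.left_commute)

lemma quadric_transpose:
  "quadric (transpose_lattice r) (transpose_lattice p) n m = quadric r p m n"
  unfolding quadric_def quadric_point_transpose by blast

lemma tangent_plane_transpose:
  "tangent_plane (transpose_lattice r) (transpose_lattice p) n m x = tangent_plane r p m n x"
  unfolding tangent_plane_def quadric_point_transpose by (subst add.commute) blast

lemma common_edge_transpose:
  "common_edge1 (transpose_lattice r) n m = common_edge2 r m n"
  "common_edge2 (transpose_lattice r) n m = common_edge1 r m n"
  by (simp_all add: common_edge1_def common_edge2_def transpose_lattice_def)

lemma shared_generator_transpose:
  "shared_generator1 (transpose_lattice r) (transpose_lattice p) n m g = shared_generator2 r p m n g"
  by (simp add: shared_generator1_def shared_generator2_def quadric_transpose common_edge_transpose)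

lemma lattice_Lie_quadrics_transpose:
  assumes "lattice_Lie_quadrics r p"
  shows "lattice_Lie_quadrics (transpose_lattice r) (transpose_lattice p)"
  using assms unfolding lattice_Lie_quadrics_def tangent_plane_transpose common_edge_transpose
  by (simp add: transpose_lattice_def)

lemma \<omega>_transpose:
  "\<omega> (transpose_lattice r) (transpose_lattice p) (transpose_lattice t) (transpose_lattice s)
     = transpose_lattice (\<omega> r p s t)"
  unfolding \<omega>_def quadric_point_transpose by (simp add: fun_eq_iff transpose_lattice_def)

lemma edge_transpose:
  "edge1 (transpose_lattice w) n m = edge2 w m n"
  "edge2 (transpose_lattice w) n m = edge1 w m n"
  by (simp_all add: edge1_def edge2_def transpose_lattice_def)

lemma envelope_transpose:
  assumes "envelope r p s t"
  shows "envelope (transpose_lattice r) (transpose_lattice p) (transpose_lattice t) (transpose_lattice s)"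
  using assms unfolding envelope_def \<omega>_transpose Let_def edge_transpose tangent_plane_transpose
  by (simp add: transpose_lattice_def)

lemma line_congruence_transpose:
  "L (transpose_lattice r) (transpose_lattice w) n m = L r w m n"
  "L1 (transpose_lattice r) (transpose_lattice w) n m = L2 r w m n"
  "L2 (transpose_lattice r) (transpose_lattice w) n m = L1 r w m n"
  "L12 (transpose_lattice r) (transpose_lattice w) n m = L12 r w m n"
  by (simp_all add: L_def L1_def L2_def L12_def transpose_lattice_def)

lemma intersection_property_transpose:
  "intersection_property1 (L (transpose_lattice r) (transpose_lattice w)) = intersection_property2 (L r w)"
  "intersection_property1 (L1 (transpose_lattice r) (transpose_lattice w)) = intersection_property2 (L2 r w)"
  "intersection_property1 (L2 (transpose_lattice r) (transpose_lattice w)) = intersection_property2 (L1 r w)"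
  "intersection_property1 (L12 (transpose_lattice r) (transpose_lattice w)) = intersection_property2 (L12 r w)"
  unfolding intersection_property1_def intersection_property2_def line_congruence_transpose
  by blast+

lemma star_transpose: "star (transpose_lattice r) n m = star r m n"
  by (auto simp: star_def transpose_lattice_def)

context
  fixes r :: net
  assumes net: "discrete_asymptotic_net r"
begin

text \<open>The transposed frame is the old one with its middle vectors exchanged, so uniqueness of
  coordinates exchanges the labels 1 and 2.\<close>

lemma frame_coords_transpose:
  "frame_coords (transpose_lattice r) m n v $ 0 = frame_coords r n m v $ 0"
  "frame_coords (transpose_lattice r) m n v $ 1 = frame_coords r n m v $ 2"
  "frame_coords (transpose_lattice r) m n v $ 2 = frame_coords r n m v $ 1"
  "frame_coords (transpose_lattice r) m n v $ 3 = frame_coords r n m v $ 3"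
proof -
  define c where "c = frame_coords r n m v"
  \<comment> \<open>The old coordinates with entries 1 and 2 swapped, the candidate for the definite
    description.\<close>
  define c' :: "real ^ 4" where "c' = (\<chi> i. if i = 1 then c $ 2 else if i = 2 then c $ 1 else c $ i)"
  have c': "c' $ 0 = c $ 0" "c' $ 1 = c $ 2" "c' $ 2 = c $ 1" "c' $ 3 = c $ 3"
    by (simp_all add: c'_def)
  have "frame_coords (transpose_lattice r) m n v = c'"
    unfolding frame_coords_def
  proof (rule the_equality)
    show "v = c' $ 0 *\<^sub>R transpose_lattice r m n + c' $ 1 *\<^sub>R transpose_lattice r (m+1) n
      + c' $ 2 *\<^sub>R transpose_lattice r m (n+1) + c' $ 3 *\<^sub>R transpose_lattice r (m+1) (n+1)"
      using frame_vector_frame_coords[OF net, of n m v]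
      unfolding c' c_def[symmetric] by (simp add: frame_vector_def transpose_lattice_def add_ac)
  next
    fix d :: "real ^ 4"
    assume "v = d $ 0 *\<^sub>R transpose_lattice r m n + d $ 1 *\<^sub>R transpose_lattice r (m+1) n
      + d $ 2 *\<^sub>R transpose_lattice r m (n+1) + d $ 3 *\<^sub>R transpose_lattice r (m+1) (n+1)"
    then have "frame_vector r n m (d $ 0) (d $ 2) (d $ 1) (d $ 3) = v"
      by (simp add: frame_vector_def transpose_lattice_def add_ac)
    then have "frame_vector r n m (d $ 0) (d $ 2) (d $ 1) (d $ 3)
        = frame_vector r n m (c $ 0) (c $ 1) (c $ 2) (c $ 3)"
      using frame_vector_frame_coords[OF net, of n m v] by (simp add: c_def)
    then have "d $ i = c' $ i" if "i \<in> {0, 1, 2, 3}" for i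
      using that unfolding frame_vector_eq_iff[OF net] by (auto simp: c')
    moreover have "i \<in> {0, 1, 2, 3}" for i :: 4
      using exhaust_4[of i] by auto
    ultimately show "d = c'" by (simp add: vec_eq_iff)
  qed
  then show
    "frame_coords (transpose_lattice r) m n v $ 0 = frame_coords r n m v $ 0"
    "frame_coords (transpose_lattice r) m n v $ 1 = frame_coords r n m v $ 2"
    "frame_coords (transpose_lattice r) m n v $ 2 = frame_coords r n m v $ 1"
    "frame_coords (transpose_lattice r) m n v $ 3 = frame_coords r n m v $ 3"
    by (simp_all add: c' c_def)
qed

text \<open>\<alpha> is exchanged with \<gamma> and \<beta> with \<delta>, along with labels 1 and
  2; this is why \<open>D1\<close> becomes \<open>D2\<close>.\<close>

lemma coefficients_transpose:
  "\<alpha> (transpose_lattice r) m n $ 0 = \<gamma> r n m $ 0"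
  "\<alpha> (transpose_lattice r) m n $ 1 = \<gamma> r n m $ 2"
  "\<alpha> (transpose_lattice r) m n $ 3 = \<gamma> r n m $ 3"
  "\<beta> (transpose_lattice r) m n $ 1 = \<delta> r n m $ 2"
  "\<beta> (transpose_lattice r) m n $ 2 = \<delta> r n m $ 1"
  "\<beta> (transpose_lattice r) m n $ 3 = \<delta> r n m $ 3"
  "\<gamma> (transpose_lattice r) m n $ 0 = \<alpha> r n m $ 0"
  "\<gamma> (transpose_lattice r) m n $ 3 = \<alpha> r n m $ 3"
  "\<delta> (transpose_lattice r) m n $ 1 = \<beta> r n m $ 2"
  "\<delta> (transpose_lattice r) m n $ 2 = \<beta> r n m $ 1"
  unfolding \<alpha>_def \<beta>_def \<gamma>_def \<delta>_def frame_coords_transpose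
  by (simp_all add: transpose_lattice_def)

lemma discrete_asymptotic_net_transpose: "discrete_asymptotic_net (transpose_lattice r)"
  unfolding discrete_asymptotic_net_def
proof (intro conjI allI)
  fix n m
  show "dim (star (transpose_lattice r) n m) \<le> 3"
    unfolding star_transpose by (rule star_coplanar[OF net])
  show "distinct [transpose_lattice r n m, transpose_lattice r (n+1) m,
      transpose_lattice r n (m+1), transpose_lattice r (n+1) (m+1)]"
    using frame_independent(1)[OF net, of m n] by (auto simp: transpose_lattice_def)
  show "independent {transpose_lattice r n m, transpose_lattice r (n+1) m,
      transpose_lattice r n (m+1), transpose_lattice r (n+1) (m+1)}"
    using frame_independent(2)[OF net, of m n] by (simp add: transpose_lattice_def insert_commute)
qed (use net in \<open>simp_all add: discrete_asymptotic_net_def coefficients_transpose\<close>)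

lemma D1_transpose: "D1 (transpose_lattice r) (transpose_lattice p) m n = D2 r p n m"
  unfolding D1_def D2_def coefficients_transpose by (simp add: transpose_lattice_def)

end

theorem corollary9p8:
  fixes r :: net and p s t :: lattice_fun
  assumes "discrete_projective_minimal r p"
    and "envelope r p s t"
    and "homogeneity_convention r p s t"
    and "\<And>n m. \<not> shared_generator1 r p n m (edge1 (\<omega> r p s t) n m)"
    and "\<And>n m. \<not> shared_generator2 r p n m (edge2 (\<omega> r p s t) n m)"
  shows "discrete_Demoulin r p \<longleftrightarrow>
    (\<exists>l \<in> {L r (\<omega> r p s t), L1 r (\<omega> r p s t), L2 r (\<omega> r p s t), L12 r (\<omega> r p s t)}.
       intersection_property1 l \<and> intersection_property2 l)"
proof -
  have net: "discrete_asymptotic_net r" and quadrics: "lattice_Lie_quadrics r p"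
    using assms(1) by (simp_all add: discrete_projective_minimal_def)
  let ?r = "transpose_lattice r" and ?p = "transpose_lattice p"
  let ?s = "transpose_lattice t" and ?t = "transpose_lattice s"
  let ?w = "\<omega> r p s t"
  interpret dir1: unshared_envelope r p s t
    by unfold_locales (fact net quadrics assms(2,4))+
  \<comment> \<open>The second direction: the first-direction results applied to the transposed net,
    with \<open>s\<close> and \<open>t\<close> in exchanged roles.\<close>
  interpret dir2: unshared_envelope ?r ?p ?s ?t
  proof
    show "\<not> shared_generator1 ?r ?p n m (edge1 (\<omega> ?r ?p ?s ?t) n m)" for n m
      unfolding \<omega>_transpose edge_transpose shared_generator_transpose by (rule assms(5))
  qed (use assms(2) net quadrics in \<open>simp_all add: discrete_asymptotic_net_transpose
    lattice_Lie_quadrics_transpose envelope_transpose\<close>)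
  show ?thesis
  proof
    assume dem: "discrete_Demoulin r p"
    have 1: "intersection_property1 (L r ?w) \<and> intersection_property1 (L2 r ?w)
        \<or> intersection_property1 (L1 r ?w) \<and> intersection_property1 (L12 r ?w)"
      using dem assms(3)
      by (intro dir1.D1_imp_intersection_property1)
        (simp_all add: discrete_Demoulin_def homogeneity_convention_def Let_def)
    have "D1 ?r ?p m n = 0" for m n
      using dem unfolding D1_transpose[OF net] by (simp add: discrete_Demoulin_def)
    moreover have "homogeneous (\<lambda>n m. \<exists>g. shared_generator1 ?r ?p n m g \<and> \<omega> ?r ?p ?s ?t n m \<in> g)"
      using assms(3) unfolding homogeneity_convention_def Let_def homogeneous_def
        shared_generator_transpose \<omega>_transpose transpose_lattice_def by blast
    ultimately have "intersection_property2 (L r ?w) \<and> intersection_property2 (L1 r ?w)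
        \<or> intersection_property2 (L2 r ?w) \<and> intersection_property2 (L12 r ?w)"
      using dir2.D1_imp_intersection_property1
      unfolding \<omega>_transpose intersection_property_transpose by blast
    \<comment> \<open>The pairs \<open>L, L2\<close> and \<open>L1, L12\<close> from the first
      direction each share exactly one congruence with each of the pairs \<open>L, L1\<close> and
      \<open>L2, L12\<close> from the second.\<close>
    with 1 show "\<exists>l \<in> {L r ?w, L1 r ?w, L2 r ?w, L12 r ?w}.
        intersection_property1 l \<and> intersection_property2 l"
      by blast
  next
    assume "\<exists>l \<in> {L r ?w, L1 r ?w, L2 r ?w, L12 r ?w}.
        intersection_property1 l \<and> intersection_property2 l"
    then obtain l where l: "l \<in> {L r ?w, L1 r ?w, L2 r ?w, L12 r ?w}"
      "intersection_property1 l" "intersection_property2 l" by blast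
    have "D1 r p n m = 0" for n m
      using dir1.intersection_property1_imp_D1[OF l(1,2)] .
    \<comment> \<open>Transposition permutes the four congruences, so membership in the family is
      preserved although \<open>L1\<close> and \<open>L2\<close> trade places.\<close>
    moreover have "\<exists>l' \<in> {L ?r (transpose_lattice ?w), L1 ?r (transpose_lattice ?w),
        L2 ?r (transpose_lattice ?w), L12 ?r (transpose_lattice ?w)}. intersection_property1 l'"
      using l(1,3) by (auto simp: intersection_property_transpose)
    then have "D1 ?r ?p m n = 0" for m n
      using dir2.intersection_property1_imp_D1 unfolding \<omega>_transpose by blast
    then have "D2 r p n m = 0" for n m
      unfolding D1_transpose[OF net] by blast
    ultimately show "discrete_Demoulin r p"
      using net quadrics by (simp add: discrete_Demoulin_def)
  qed
qed

end
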